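(* Let $\mathsf{M}$ be a loopless matroid on a finite ground set $E$, and let $i\in E$ be an element that is not a coloop. Let \[\mathscr{T}_i = \{F\in\mathcal{L}(\mathsf{M}) : i\in F \text{ and } F\smallsetminus\{i\}\notin\mathcal{L}(\mathsf{M})\}.\] Then \begin{align*} Q_{\mathsf{M}}(x) &= Q_{\mathsf{M}\smallsetminus i}(x) + (1+x)\, Q_{\mathsf{M}/i}(x) - \sum_{F\in\mathscr{T}_i} \tau(\mathsf{M}|_F/i)\, x^{\operatorname{rk}(F)/2}\, Q_{\mathsf{M}/F}(x),\\ Y_{\mathsf{M}}(x) &= Y_{\mathsf{M}\smallsetminus i}(x) + (1+x)\, Y_{\mathsf{M}/i}(x) - \sum_{F\in\mathscr{T}_i} \tau(\mathsf{M}|_F/i)\, x^{\operatorname{rk}(F)/2}\, Y_{\mathsf{M}/F}(x). \end{align*}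
   Context: $\mathcal{L}(\mathsf{M})$ is the lattice of flats, $\operatorname{rk}$ the rank function of $\mathsf{M}$; $\mathsf{M}\smallsetminus i$, $\mathsf{M}/i$, $\mathsf{M}|_F$, $\mathsf{M}/F$ denote deletion, contraction, restriction and contraction. All polynomial invariants below depend only on the lattice of flats; for a matroid with loops they are taken to be those of its simplification. For a loopless matroid $\mathsf{N}$, $\mu(\mathsf{N})$ is the Möbius function value $\mu(\varnothing,E)$ of $\mathcal{L}(\mathsf{N})$. The Kazhdan–Lusztig polynomial $P_{\mathsf{N}}(x)\in\mathbb{Z}[x]$ is the unique assignment such that $P_{\mathsf{N}}=1$ if $\operatorname{rk}(\mathsf{N})=0$, $\deg P_{\mathsf{N}}<\operatorname{rk}(\mathsf{N})/2$ if $\operatorname{rk}(\mathsf{N})>0$, and $\sum_{F\in\mathcal{L}(\mathsf{N})} x^{\operatorname{rk}(F)}P_{\mathsf{N}/F}(x)$ is palindromic (of degree $\operatorname{rk}\mathsf{N}$, i.e. invariant under $f(x)\mapsto x^{\operatorname{rk}\mathsf{N}}f(1/x)$). The inverse Kazhdan–Lusztig polynomial $Q_{\mathsf{N}}(x)\in\mathbb{Z}[x]$ is the unique assignment such that $Q_{\mathsf{N}}=1$ if $\operatorname{rk}(\mathsf{N})=0$, $\deg Q_{\mathsf{N}}<\operatorname{rk}(\mathsf{N})/2$ if $\operatorname{rk}(\mathsf{N})>0$, and the inverse $Z$-polynomial \[Y_{\mathsf{N}}(x):=\sum_{F\in\mathcal{L}(\mathsf{N})}(-1)^{\operatorname{rk}\mathsf{N}-\operatorname{rk}F}\mu(\mathsf{N}/F)\,x^{\operatorname{rk}\mathsf{N}-\operatorname{rk}F}\,Q_{\mathsf{N}|_F}(x)\]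 is palindromic. Finally $\tau(\mathsf{N})$ is the coefficient of $x^{(\operatorname{rk}(\mathsf{N})-1)/2}$ in $P_{\mathsf{N}}(x)$ if $\operatorname{rk}(\mathsf{N})$ is odd, and $0$ if it is even.
   Formalization: The formal statement additionally assumes that {i} is a flat, i.e. i has no parallel elements; with loops handled by simplification, the formula for Q fails whenever i has a parallel element (e.g. for U_{1,2} it reads 1 = 2 + x). *)

theory Defs
  imports "HOL-Computational_Algebra.Polynomial" "HOL-Library.FuncSet"
begin

section \<open>Finite matroids\<close>

record 'a matroid =
  ground :: "'a set"
  indep :: "'a set \<Rightarrow> bool"

locale finite_matroid =
  fixes M :: "'a matroid"
  assumes finite_ground: "finite (ground M)"
    and indep_subset_ground: "indep M X \<Longrightarrow> X \<subseteq> ground M"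
    and indep_empty: "indep M {}"
    and indep_subset: "indep M Y \<Longrightarrow> X \<subseteq> Y \<Longrightarrow> indep M X"
    and indep_augment:
      "indep M X \<Longrightarrow> indep M Y \<Longrightarrow> card X < card Y \<Longrightarrow> \<exists>e\<in>Y - X. indep M (insert e X)"

definition basis :: "'a matroid \<Rightarrow> 'a set \<Rightarrow> bool" where
  "basis M B \<longleftrightarrow> indep M B \<and> (\<forall>X. indep M X \<and> B \<subseteq> X \<longrightarrow> X = B)"

definition loopless :: "'a matroid \<Rightarrow> bool" where
  "loopless M \<longleftrightarrow> (\<forall>e\<in>ground M. indep M {e})"

definition coloop :: "'a matroid \<Rightarrow> 'a \<Rightarrow> bool" where
  "coloop M e \<longleftrightarrow> e \<in> ground M \<and> (\<forall>B. basis M B \<longrightarrow> e \<in> B)"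

definition rk :: "'a matroid \<Rightarrow> 'a set \<Rightarrow> nat" where
  "rk M X = Max (card ` {I. indep M I \<and> I \<subseteq> X})"

abbreviation rank :: "'a matroid \<Rightarrow> nat" where
  "rank M \<equiv> rk M (ground M)"

definition flats :: "'a matroid \<Rightarrow> 'a set set" where
  "flats M = {F. F \<subseteq> ground M \<and> (\<forall>e\<in>ground M - F. rk M F < rk M (insert e F))}"

definition restriction :: "'a matroid \<Rightarrow> 'a set \<Rightarrow> 'a matroid" where
  "restriction M A = \<lparr>ground = A, indep = (\<lambda>X. indep M X \<and> X \<subseteq> A)\<rparr>"

definition deletion :: "'a matroid \<Rightarrow> 'a set \<Rightarrow> 'a matroid" where
  "deletion M A = restriction M (ground M - A)"

definition contraction :: "'a matroid \<Rightarrow> 'a set \<Rightarrow> 'a matroid" where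
  "contraction M A =
     \<lparr>ground = ground M - A,
      indep = (\<lambda>X. X \<subseteq> ground M - A \<and> (\<exists>B. basis (restriction M A) B \<and> indep M (X \<union> B)))\<rparr>"

text \<open>The simplification keeps one non-loop from every parallel class; the parallel
  classes are the sets of non-loops of the flats of rank one.\<close>

definition simplification :: "'a matroid \<Rightarrow> 'a matroid" where
  "simplification M =
     restriction M ((\<lambda>F. SOME e. e \<in> F \<and> indep M {e}) ` {F \<in> flats M. rk M F = 1})"


section \<open>The Moebius function\<close>

text \<open>Moebius function of a family \<open>L\<close> of sets ordered by inclusion. The test for
  finiteness only serves termination.\<close>

function moebius :: "'a set set \<Rightarrow> 'a set \<Rightarrow> 'a set \<Rightarrow> int" where
  "moebius L A B =
     (if A = B then 1
      else if A \<subset> B \<and> finite B then - (\<Sum>C \<in> {C \<in> L. A \<subseteq> C \<and> C \<subset> B}. moebius L A C)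
      else 0)"
  by auto
termination
  by (relation "measure (\<lambda>(L, A, B). card B)") (auto simp: psubset_card_mono)

declare moebius.simps [simp del]

definition moebius_invariant :: "'a matroid \<Rightarrow> int" where
  "moebius_invariant N = moebius (flats N) {} (ground N)"


section \<open>Kazhdan--Lusztig and inverse Kazhdan--Lusztig polynomials\<close>

text \<open>Invariance under \<open>f(x) \<mapsto> x\<^sup>r f(1/x)\<close>, where \<open>reflect_poly f\<close> is
  \<open>x\<^sup>d f(1/x)\<close> with \<open>d\<close> the degree of \<open>f\<close>.\<close>

definition palindromic :: "nat \<Rightarrow> int poly \<Rightarrow> bool" where
  "palindromic r f \<longleftrightarrow> degree f \<le> r \<and> monom 1 (r - degree f) * reflect_poly f = f"

definition loopless_matroids :: "'a matroid set" where
  "loopless_matroids = {N. finite_matroid N \<and> loopless N}"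

text \<open>The polynomials are defined as unique assignments on the loopless matroids whose
  ground set lies in a given type; this class is closed under contracting a flat and restricting
  to a flat. Membership in \<open>extensional\<close> pins down the values elsewhere, so that the
  assignment is unique as a total function.\<close>

definition Z_sum :: "('a matroid \<Rightarrow> int poly) \<Rightarrow> 'a matroid \<Rightarrow> int poly" where
  "Z_sum P N = (\<Sum>F\<in>flats N. monom 1 (rk N F) * P (contraction N F))"

definition KL_assignment :: "('a matroid \<Rightarrow> int poly) \<Rightarrow> bool" where
  "KL_assignment P \<longleftrightarrow> P \<in> extensional loopless_matroids \<and>
     (\<forall>N\<in>loopless_matroids.
        (rank N = 0 \<longrightarrow> P N = 1) \<and>
        (rank N > 0 \<longrightarrow> 2 * degree (P N) < rank N) \<and>
        palindromic (rank N) (Z_sum P N))"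

definition inv_Z_sum :: "('a matroid \<Rightarrow> int poly) \<Rightarrow> 'a matroid \<Rightarrow> int poly" where
  "inv_Z_sum Q N =
     (\<Sum>F\<in>flats N.
        monom ((-1) ^ (rank N - rk N F) * moebius_invariant (contraction N F)) (rank N - rk N F)
        * Q (restriction N F))"

definition inv_KL_assignment :: "('a matroid \<Rightarrow> int poly) \<Rightarrow> bool" where
  "inv_KL_assignment Q \<longleftrightarrow> Q \<in> extensional loopless_matroids \<and>
     (\<forall>N\<in>loopless_matroids.
        (rank N = 0 \<longrightarrow> Q N = 1) \<and>
        (rank N > 0 \<longrightarrow> 2 * degree (Q N) < rank N) \<and>
        palindromic (rank N) (inv_Z_sum Q N))"

text \<open>The invariants of a matroid with loops are those of its simplification.\<close>

definition remove_loops :: "'a matroid \<Rightarrow> 'a matroid" where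
  "remove_loops N = (if loopless N then N else simplification N)"

definition KL_poly :: "'a matroid \<Rightarrow> int poly" where
  "KL_poly N = (THE P. KL_assignment P) (remove_loops N)"

definition inv_KL_poly :: "'a matroid \<Rightarrow> int poly" where
  "inv_KL_poly N = (THE Q. inv_KL_assignment Q) (remove_loops N)"

definition inv_Z_poly :: "'a matroid \<Rightarrow> int poly" where
  "inv_Z_poly N = inv_Z_sum inv_KL_poly (remove_loops N)"

definition tau :: "'a matroid \<Rightarrow> int" where
  "tau N = (if odd (rank N) then coeff (KL_poly N) ((rank N - 1) div 2) else 0)"

definition deletion_flats :: "'a matroid \<Rightarrow> 'a \<Rightarrow> 'a set set" where
  "deletion_flats M i = {F \<in> flats M. i \<in> F \<and> F - {i} \<notin> flats M}"

text \<open>If \<open>i\<close> is not a loop, then \<open>M|F/i\<close> has rank \<open>rk(F) - 1\<close>, so its \<open>tau\<close>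
  vanishes unless \<open>rk(F)\<close> is even: the truncating exponent \<open>rk M F div 2\<close> is exact wherever
  the coefficient is nonzero.

  If \<open>i\<close> is parallel to another element, then \<open>M/i\<close> has loops and, with
  \<open>remove_loops\<close> as above, the deletion formulas fail. For the uniform matroid of rank 1 on
  two elements all three of \<open>M\<close>, \<open>M - i\<close>, \<open>M/i\<close> have inverse Kazhdan--Lusztig polynomial 1
  and every \<open>tau\<close> that occurs is 0, so the right-hand side would be \<open>2 + x\<close>. The formulas are
  therefore stated for \<open>{i}\<close> a flat, that is, for \<open>i\<close> without parallel elements.\<close>

end

theory Submission
  imports Defs
begin

text \<open>
  For a flat \<open>F\<close> containing \<open>i\<close>, write \<open>D F\<close> for the right-hand side of the formula for \<open>Q\<close>,
  applied to the restriction to \<open>F\<close>, where the deletion term is multiplied by \<open>-x\<close> if \<open>i\<close> is a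
  coloop of that restriction. Replacing \<open>Q\<close> by \<open>D\<close> in the sum that defines \<open>Y\<close> gives exactly the
  right-hand side of the formula for \<open>Y\<close> (with deletion term \<open>0\<close> if \<open>i\<close> is a coloop): for the
  deletion term because
  \<open>\<Sum> {\<mu>(F, E) | F - {i} = G}\<close> is the Moebius function of the lattice of flats of the deletion,
  for the other terms by exchanging summations. That right-hand side is palindromic, so by the
  uniqueness of \<open>Q\<close> and induction on the ground set, \<open>Q = D\<close> follows once \<open>D\<close> has degree less
  than half the rank. In the critical degree, \<open>(1 + x) Q\<^bsub>M/i\<^esub>\<close> contributes the top coefficient
  of \<open>Q\<^bsub>M/i\<^esub>\<close>, and the summand for \<open>F = E\<close> cancels it, since \<open>P\<close> and \<open>Q\<close> have the same
  coefficient in degree \<open>(r - 1)/2\<close> for odd rank \<open>r\<close>: this is read off from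
  \<open>\<Sum>\<^sub>F (-1)\<^bsup>rk F\<^esup> Q\<^bsub>M|F\<^esub> P\<^bsub>M/F\<^esub> = 0\<close>.
\<close>

section \<open>Palindromic polynomials\<close>

text \<open>Reversal at a prescribed degree \<open>r\<close> instead of the actual degree, so that
  it is additive (\<open>revp_sum\<close>) and multiplicative (\<open>revp_mult\<close>). It means
  \<open>x^r f(1/x)\<close> only when \<open>degree f \<le> r\<close>.\<close>

definition revp :: "nat \<Rightarrow> int poly \<Rightarrow> int poly" where
  "revp r f = monom 1 (r - degree f) * reflect_poly f"

lemma coeff_revp:
  assumes "degree f \<le> r"
  shows "coeff (revp r f) k = (if k \<le> r then coeff f (r - k) else 0)"
  using assms
  by (auto simp: revp_def coeff_monom_mult coeff_reflect_poly coeff_eq_0)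

lemma palindromic_iff_revp: "palindromic r f \<longleftrightarrow> degree f \<le> r \<and> revp r f = f"
  by (simp add: palindromic_def revp_def)

lemma palindromic_iff_coeff:
  "palindromic r f \<longleftrightarrow> degree f \<le> r \<and> (\<forall>k\<le>r. coeff f (r - k) = coeff f k)"
proof (cases "degree f \<le> r")
  case True
  then have "revp r f = f \<longleftrightarrow> (\<forall>k. (if k \<le> r then coeff f (r - k) else 0) = coeff f k)"
    by (simp add: poly_eq_iff coeff_revp)
  moreover have "coeff f k = 0" if "\<not> k \<le> r" for k
    using that True by (intro coeff_eq_0) simp
  ultimately show ?thesis using True unfolding palindromic_iff_revp by (metis (full_types))
qed (simp add: palindromic_iff_revp)

lemma revp_mult:
  assumes "degree f \<le> r" "degree g \<le> s"
  shows "revp (r + s) (f * g) = revp r f * revp s g"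
proof (cases "f = 0 \<or> g = 0")
  case True
  then show ?thesis by (auto simp: revp_def)
next
  case False
  then have "r + s - degree (f * g) = (r - degree f) + (s - degree g)"
    using assms by (simp add: degree_mult_eq)
  then have "monom (1::int) (r + s - degree (f * g)) = monom 1 (r - degree f) * monom 1 (s - degree g)"
    by (simp add: mult_monom)
  then show ?thesis
    by (simp add: revp_def reflect_poly_mult mult_ac)
qed

lemma revp_sum:
  assumes "finite S" "\<And>x. x \<in> S \<Longrightarrow> degree (f x) \<le> r"
  shows "revp r (\<Sum>x\<in>S. f x) = (\<Sum>x\<in>S. revp r (f x))"
  by (rule poly_eqI)
    (simp add: coeff_revp degree_sum_le[OF assms] coeff_sum assms(2))

lemma revp_monom:
  assumes "n \<le> r"
  shows "revp r (monom c n) = monom c (r - n)"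
  using assms by (intro poly_eqI) (auto simp: coeff_revp degree_monom_le[THEN le_trans])

lemma palindromic_0: "palindromic r 0"
  by (simp add: palindromic_iff_coeff)

lemma palindromic_add: "palindromic r f \<Longrightarrow> palindromic r g \<Longrightarrow> palindromic r (f + g)"
  by (simp add: palindromic_iff_coeff degree_add_le)

lemma palindromic_diff: "palindromic r f \<Longrightarrow> palindromic r g \<Longrightarrow> palindromic r (f - g)"
  by (simp add: palindromic_iff_coeff degree_diff_le)

lemma palindromic_sum: "(\<And>x. x \<in> S \<Longrightarrow> palindromic r (f x)) \<Longrightarrow> palindromic r (\<Sum>x\<in>S. f x)"
  by (induction S rule: infinite_finite_induct) (auto simp: palindromic_0 palindromic_add)

lemma palindromic_mult:
  "palindromic r f \<Longrightarrow> palindromic s g \<Longrightarrow> palindromic (r + s) (f * g)"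
  by (auto simp: palindromic_iff_revp revp_mult intro: degree_mult_le[THEN le_trans])

lemma palindromic_monom: "palindromic (2 * n) (monom c n)"
  by (auto simp: palindromic_iff_revp revp_monom intro: degree_monom_le[THEN le_trans])

lemma palindromic_1_plus_X: "palindromic (Suc 0) [:1, 1:]"
  by (auto simp: palindromic_iff_coeff coeff_pCons le_Suc_eq split: nat.splits)

text \<open>The mirror image of each index up to \<open>degree f\<close> lies above
  \<open>degree f\<close>, where coefficients vanish. This is the uniqueness principle behind all
  the invariants.\<close>

lemma palindromic_low_degree_eq_0:
  assumes "palindromic r f" "2 * degree f < r"
  shows "f = 0"
proof (rule poly_eqI)
  fix k
  show "coeff f k = coeff 0 k"
  proof (cases "k \<le> degree f")
    case True
    then have "coeff f (r - k) = 0" using assms(2) by (intro coeff_eq_0) linarith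
    then show ?thesis using True assms by (simp add: palindromic_iff_coeff)
  qed (simp add: coeff_eq_0)
qed

text \<open>Existence counterpart: the lower half of the coefficients can be adjusted freely to
  match the upper half, and for even \<open>r\<close> the middle one is its own mirror
  image.\<close>

lemma ex_palindromic_completion:
  assumes "degree t \<le> r" "0 < r"
  shows "\<exists>p. 2 * degree p < r \<and> palindromic r (p + t)"
proof -
  \<comment> \<open>The range consists of the \<open>k\<close> with \<open>2 * k < r\<close>; each
    coefficient of \<open>p\<close> is the defect of \<open>t\<close> at \<open>k\<close> against
    its mirror index.\<close>
  define p where "p = (\<Sum>k<(r + 1) div 2. monom (coeff t (r - k) - coeff t k) k)"
  have less_iff: "k < (r + 1) div 2 \<longleftrightarrow> 2 * k < r" for k by linarith
  have coeff_p: "coeff p k = (if 2 * k < r then coeff t (r - k) - coeff t k else 0)" for k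
    unfolding p_def coeff_sum coeff_monom less_iff[symmetric] by simp
  have deg: "2 * degree p < r"
  proof (cases "p = 0")
    case False
    then show ?thesis using coeff_p[of "degree p"] by (auto simp: leading_coeff_0_iff split: if_splits)
  qed (use assms in simp)
  have "palindromic r (p + t)"
    unfolding palindromic_iff_coeff
  proof (intro conjI allI impI)
    show "degree (p + t) \<le> r" using deg assms by (intro degree_add_le) auto
    show "coeff (p + t) (r - k) = coeff (p + t) k" if "k \<le> r" for k
    proof (cases "2 * k = r")
      case True
      then have "r - k = k" by linarith
      then show ?thesis by simp
    next
      case False
      then have "2 * k < r \<longleftrightarrow> \<not> 2 * (r - k) < r" using that by linarith
      then show ?thesis using that by (auto simp: coeff_p)
    qed
  qed
  with deg show ?thesis by blast
qed


section \<open>Moebius inversion in a finite family of sets\<close>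

lemma moebius_refl: "moebius L A A = 1"
  by (simp add: moebius.simps)

lemma moebius_not_subset: "\<not> A \<subseteq> B \<Longrightarrow> moebius L A B = 0"
  by (subst moebius.simps) auto

lemma moebius_sum_below:
  assumes "finite L" "B \<in> L" "finite B" "A \<subseteq> B"
  shows "(\<Sum>C | C \<in> L \<and> A \<subseteq> C \<and> C \<subseteq> B. moebius L A C) = (if A = B then 1 else 0)"
proof -
  have "{C. C \<in> L \<and> A \<subseteq> C \<and> C \<subseteq> B} = insert B {C \<in> L. A \<subseteq> C \<and> C \<subset> B}"
    using assms by auto
  then have "(\<Sum>C | C \<in> L \<and> A \<subseteq> C \<and> C \<subseteq> B. moebius L A C) =
      moebius L A B + (\<Sum>C\<in>{C \<in> L. A \<subseteq> C \<and> C \<subset> B}. moebius L A C)"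
    using assms by simp
  also have "\<dots> = (if A = B then 1 else 0)"
  proof (cases "A = B")
    case True
    then have empty: "{C \<in> L. A \<subseteq> C \<and> C \<subset> B} = {}" by auto
    show ?thesis unfolding empty using True by (simp add: moebius.simps[of L B B])
  qed (use assms in \<open>simp add: moebius.simps[of L A B] psubset_eq\<close>)
  finally show ?thesis .
qed

section \<open>The incidence algebra of a finite family of sets\<close>

definition conv :: "'a set set \<Rightarrow> ('a set \<Rightarrow> 'a set \<Rightarrow> 'b::semiring_1) \<Rightarrow>
    ('a set \<Rightarrow> 'a set \<Rightarrow> 'b) \<Rightarrow> 'a set \<Rightarrow> 'a set \<Rightarrow> 'b" where
  "conv L f g A B = (\<Sum>C\<in>L. f A C * g C B)"

definition zeta :: "'a set \<Rightarrow> 'a set \<Rightarrow> 'b::semiring_1" where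
  "zeta A B = of_bool (A \<subseteq> B)"

definition delta :: "'a set \<Rightarrow> 'a set \<Rightarrow> 'b::semiring_1" where
  "delta A B = of_bool (A = B)"

lemma conv_assoc: "conv L (conv L f g) h = conv L f (conv L g h)"
proof (intro ext)
  fix A B
  have "(\<Sum>C\<in>L. \<Sum>D\<in>L. f A D * g D C * h C B) = (\<Sum>D\<in>L. \<Sum>C\<in>L. f A D * g D C * h C B)"
    by (rule sum.swap)
  then show "conv L (conv L f g) h A B = conv L f (conv L g h) A B"
    by (simp add: conv_def sum_distrib_left sum_distrib_right mult.assoc)
qed

lemma conv_cong:
  assumes "\<And>C. C \<in> L \<Longrightarrow> f A C = f' A C" "\<And>C. C \<in> L \<Longrightarrow> g C B = g' C B"
  shows "conv L f g A B = conv L f' g' A B"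
  unfolding conv_def using assms by (intro sum.cong) auto

lemma conv_delta_left: "finite L \<Longrightarrow> A \<in> L \<Longrightarrow> conv L delta f A B = f A B"
  by (simp add: conv_def delta_def of_bool_def if_distrib[of "\<lambda>x. x * _"] sum.delta cong: if_cong)

lemma conv_delta_right: "finite L \<Longrightarrow> B \<in> L \<Longrightarrow> conv L f delta A B = f A B"
  by (simp add: conv_def delta_def of_bool_def if_distrib[of "\<lambda>x. _ * x"] sum.delta cong: if_cong)

text \<open>\<open>conv\<close> sums over the whole family, which makes associativity a mere
  exchange of sums; for factors supported on inclusions it is the usual product over
  intervals.\<close>

lemma conv_restrict:
  assumes "finite L" "\<And>A B. \<not> A \<subseteq> B \<Longrightarrow> f A B = 0" "\<And>A B. \<not> A \<subseteq> B \<Longrightarrow> g A B = 0"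
  shows "conv L f g A B = (\<Sum>C | C \<in> L \<and> A \<subseteq> C \<and> C \<subseteq> B. f A C * g C B)"
proof -
  have "f A C * g C B = 0" if "\<not> (A \<subseteq> C \<and> C \<subseteq> B)" for C
    using that assms(2)[of A C] assms(3)[of C B] by (metis mult_zero_left mult_zero_right)
  then show ?thesis
    unfolding conv_def using assms(1) by (intro sum.mono_neutral_right) blast+
qed

lemma moebius_conv_zeta:
  assumes "finite L" "B \<in> L" "finite B"
  shows "conv L (moebius L) zeta A B = delta A B"
proof (cases "A \<subseteq> B")
  case True
  then show ?thesis
    using moebius_sum_below[OF assms True] assms
    by (subst conv_restrict) (auto simp: moebius_not_subset zeta_def delta_def intro!: sum.cong)
next
  case False
  then have "\<forall>C\<in>L. moebius L A C * zeta C B = 0"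
    by (auto simp: zeta_def intro: moebius_not_subset)
  with False show ?thesis by (auto simp: conv_def delta_def intro!: sum.neutral)
qed

text \<open>Complementation reverses inclusion, so the Moebius function of the complementary family
  is a right inverse of zeta; it therefore agrees with the left inverse.\<close>

lemma zeta_conv_moebius:
  assumes L: "finite L" and sub: "\<And>B. B \<in> L \<Longrightarrow> B \<subseteq> E" and E: "finite E"
    and AB: "A \<in> L" "B \<in> L"
  shows "conv L zeta (moebius L) A B = delta A B"
proof -
  define L' where "L' = (\<lambda>F. E - F) ` L"
  define \<nu> where "\<nu> A B = moebius L' (E - B) (E - A)" for A B
  have inj: "inj_on (\<lambda>F. E - F) L" using sub by (intro inj_onI) blast
  have \<nu>: "conv L zeta \<nu> A B = delta A B" if AB: "A \<in> L" "B \<in> L" for A B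
  proof -
    have "conv L zeta \<nu> A B = conv L' (moebius L') zeta (E - B) (E - A)"
      unfolding conv_def L'_def sum.reindex[OF inj] comp_def
    proof (intro sum.cong refl)
      fix C assume "C \<in> L"
      then show "zeta A C * \<nu> C B = moebius ((\<lambda>F. E - F) ` L) (E - B) (E - C) * zeta (E - C) (E - A)"
        using sub[of C] sub[OF AB(1)] by (auto simp: zeta_def \<nu>_def L'_def)
    qed
    also have "\<dots> = delta (E - B) (E - A)"
      using AB L E by (intro moebius_conv_zeta) (auto simp: L'_def)
    also have "\<dots> = delta A B"
      using sub[OF AB(1)] sub[OF AB(2)] by (auto simp: delta_def)
    finally show ?thesis .
  qed
  have \<nu>_moebius: "\<nu> A B = moebius L A B" if AB: "A \<in> L" "B \<in> L" for A B
  proof -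
    have "\<nu> A B = conv L delta \<nu> A B"
      using L AB by (simp add: conv_delta_left)
    also have "\<dots> = conv L (conv L (moebius L) zeta) \<nu> A B"
      using moebius_conv_zeta[OF L _ finite_subset[OF sub E]] by (intro conv_cong) simp_all
    also have "\<dots> = conv L (moebius L) delta A B"
      unfolding conv_assoc using AB \<nu> by (intro conv_cong) simp_all
    finally show ?thesis using L AB by (simp add: conv_delta_right)
  qed
  show ?thesis
    unfolding \<nu>[OF AB, symmetric] using \<nu>_moebius AB(2) by (intro conv_cong) simp_all
qed

text \<open>Induction on the number of members above \<open>A\<close>: the terms strictly above
  agree already, so equal up-set sums force equal terms at \<open>A\<close>. It serves to recognize
  Moebius values from their up-set sums.\<close>

lemma sum_above_inject:
  fixes g h :: "'a set \<Rightarrow> int"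
  assumes L: "finite L"
    and eq: "\<And>A. A \<in> L \<Longrightarrow> (\<Sum>C | C \<in> L \<and> A \<subseteq> C. g C) = (\<Sum>C | C \<in> L \<and> A \<subseteq> C. h C)"
    and A: "A \<in> L"
  shows "g A = h A"
  using A
proof (induction "card {C \<in> L. A \<subseteq> C}" arbitrary: A rule: less_induct)
  case less
  let ?S = "{C \<in> L. A \<subset> C}"
  have split: "{C. C \<in> L \<and> A \<subseteq> C} = insert A ?S" using less.prems by auto
  have "g C = h C" if C: "C \<in> ?S" for C
  proof (rule less.hyps)
    have "{D \<in> L. C \<subseteq> D} \<subset> {D \<in> L. A \<subseteq> D}" using C less.prems by auto
    then show "card {D \<in> L. C \<subseteq> D} < card {D \<in> L. A \<subseteq> D}"
      using L by (intro psubset_card_mono) simp_all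
  qed (use C in simp)
  then have "(\<Sum>C\<in>?S. g C) = (\<Sum>C\<in>?S. h C)" by (rule sum.cong[OF refl])
  with eq[OF less.prems] L show ?case unfolding split by simp
qed

text \<open>\<open>\<lambda>C. C - A\<close> is an order isomorphism on the members between
  \<open>A\<close> and \<open>T\<close>, and the recursion for the value at \<open>A\<close>,
  \<open>B\<close> never leaves the interval from \<open>A\<close> to \<open>B\<close>.\<close>

lemma moebius_interval_shift:
  assumes "finite B" "A \<subseteq> B" "B \<subseteq> T"
  shows "moebius ((\<lambda>C. C - A) ` {C \<in> L. A \<subseteq> C \<and> C \<subseteq> T}) {} (B - A) = moebius L A B"
  using assms
proof (induction "card B" arbitrary: B rule: less_induct)
  case less
  let ?L = "(\<lambda>C. C - A) ` {C \<in> L. A \<subseteq> C \<and> C \<subseteq> T}"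
  show ?case
  proof (cases "A = B")
    case True
    then show ?thesis by (simp add: moebius.simps)
  next
    case False
    with less.prems have AB: "A \<subset> B" by blast
    have "(\<Sum>C\<in>{C \<in> ?L. {} \<subseteq> C \<and> C \<subset> B - A}. moebius ?L {} C) =
        (\<Sum>C\<in>{C \<in> L. A \<subseteq> C \<and> C \<subset> B}. moebius L A C)"
    proof (rule sum.reindex_cong[of "\<lambda>C. C - A"])
      show "inj_on (\<lambda>C. C - A) {C \<in> L. A \<subseteq> C \<and> C \<subset> B}"
        by (intro inj_onI) blast
      show "{C \<in> ?L. {} \<subseteq> C \<and> C \<subset> B - A} = (\<lambda>C. C - A) ` {C \<in> L. A \<subseteq> C \<and> C \<subset> B}"
      proof (intro equalityI subsetI)
        fix X assume "X \<in> {C \<in> ?L. {} \<subseteq> C \<and> C \<subset> B - A}"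
        then obtain C where C: "C \<in> L" "A \<subseteq> C" "X = C - A" "C - A \<subset> B - A" by blast
        then have "C \<in> {C \<in> L. A \<subseteq> C \<and> C \<subset> B}" using AB by blast
        with C(3) show "X \<in> (\<lambda>C. C - A) ` {C \<in> L. A \<subseteq> C \<and> C \<subset> B}" by blast
      next
        fix X assume "X \<in> (\<lambda>C. C - A) ` {C \<in> L. A \<subseteq> C \<and> C \<subset> B}"
        then obtain C where C: "C \<in> L" "A \<subseteq> C" "C \<subset> B" "X = C - A" by blast
        moreover have "C - A \<subset> B - A" using C by blast
        moreover have "C \<subseteq> T" using C less.prems by blast
        ultimately show "X \<in> {C \<in> ?L. {} \<subseteq> C \<and> C \<subset> B - A}" by blast
      qed
      show "moebius ?L {} (C - A) = moebius L A C" if "C \<in> {C \<in> L. A \<subseteq> C \<and> C \<subset> B}" for C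
      proof (rule less.hyps)
        have C: "A \<subseteq> C" "C \<subset> B" using that by blast+
        then show "card C < card B" "finite C" "A \<subseteq> C" "C \<subseteq> T"
          using less.prems by (auto intro: psubset_card_mono dest: finite_subset)
      qed
    qed
    moreover have "{} \<noteq> B - A" "{} \<subset> B - A" "finite (B - A)" using AB less.prems by auto
    then have "moebius ?L {} (B - A) = - (\<Sum>C\<in>{C \<in> ?L. {} \<subseteq> C \<and> C \<subset> B - A}. moebius ?L {} C)"
      by (subst moebius.simps) (simp only: if_False if_True simp_thms)
    moreover have "moebius L A B = - (\<Sum>C\<in>{C \<in> L. A \<subseteq> C \<and> C \<subset> B}. moebius L A C)"
      using False AB less.prems(1) by (subst moebius.simps) (simp only: if_False if_True simp_thms)
    ultimately show ?thesis by (simp only:)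
  qed
qed


section \<open>Rank and minors of matroids\<close>

text \<open>The matroid of an interval in the lattice of flats. With both ends as parameters,
  iterated minors keep this shape (\<open>minor_minor\<close>).\<close>

definition minor :: "'a matroid \<Rightarrow> 'a set \<Rightarrow> 'a set \<Rightarrow> 'a matroid" where
  "minor M A B = contraction (restriction M B) A"

definition closure_of :: "'a matroid \<Rightarrow> 'a set \<Rightarrow> 'a set" where
  "closure_of M X = {e \<in> ground M. rk M (insert e X) = rk M X}"

lemma ground_restriction [simp]: "ground (restriction M A) = A"
  by (simp add: restriction_def)

lemma ground_contraction [simp]: "ground (contraction M A) = ground M - A"
  by (simp add: contraction_def)

lemma ground_deletion [simp]: "ground (deletion M A) = ground M - A"
  by (simp add: deletion_def)

lemma ground_minor [simp]: "ground (minor M A B) = B - A"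
  by (simp add: minor_def)

lemma indep_restriction [simp]: "indep (restriction M A) X \<longleftrightarrow> indep M X \<and> X \<subseteq> A"
  by (simp add: restriction_def)

lemma restriction_restriction: "B \<subseteq> A \<Longrightarrow> restriction (restriction M A) B = restriction M B"
  by (auto simp: restriction_def fun_eq_iff)

lemma rk_restriction: "rk (restriction M A) X = rk M (X \<inter> A)"
proof -
  have "{I. indep M I \<and> I \<subseteq> A \<and> I \<subseteq> X} = {I. indep M I \<and> I \<subseteq> X \<inter> A}" by blast
  then show ?thesis by (simp add: rk_def conj_assoc)
qed

lemma flats_subset_ground: "F \<in> flats M \<Longrightarrow> F \<subseteq> ground M"
  by (simp add: flats_def)

lemma ground_in_flats: "ground M \<in> flats M"
  by (simp add: flats_def)

section \<open>The rank function\<close>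

context finite_matroid
begin

lemma finite_indep: "indep M X \<Longrightarrow> finite X"
  using finite_ground indep_subset_ground by (blast intro: finite_subset)

lemma finite_flats: "finite (flats M)"
  by (rule finite_subset[of _ "Pow (ground M)"]) (auto simp: flats_def finite_ground)

lemma finite_indep_subsets: "finite {I. indep M I \<and> I \<subseteq> X}"
  by (rule finite_subset[of _ "Pow (ground M)"]) (auto dest: indep_subset_ground simp: finite_ground)

lemma card_le_rk: "indep M I \<Longrightarrow> I \<subseteq> X \<Longrightarrow> card I \<le> rk M X"
  unfolding rk_def by (rule Max_ge) (use finite_indep_subsets in auto)

lemma rk_leI:
  assumes "\<And>I. indep M I \<Longrightarrow> I \<subseteq> X \<Longrightarrow> card I \<le> n"
  shows "rk M X \<le> n"
  unfolding rk_def
  by (rule Max.boundedI) (use assms indep_empty finite_indep_subsets in auto)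

lemma ex_indep_card_rk: "\<exists>I. indep M I \<and> I \<subseteq> X \<and> card I = rk M X"
proof -
  have "rk M X \<in> card ` {I. indep M I \<and> I \<subseteq> X}"
    unfolding rk_def by (rule Max_in) (use indep_empty finite_indep_subsets in auto)
  then show ?thesis by auto
qed

text \<open>A largest independent set between \<open>I\<close> and \<open>X\<close> has full rank,
  since otherwise augmentation from an independent subset of \<open>X\<close> of full rank would
  enlarge it.\<close>

lemma indep_extend:
  assumes "indep M I" "I \<subseteq> X"
  obtains J where "indep M J" "I \<subseteq> J" "J \<subseteq> X" "card J = rk M X"
proof -
  let ?S = "{J. indep M J \<and> I \<subseteq> J \<and> J \<subseteq> X}"
  have "finite ?S"
    by (rule finite_subset[OF _ finite_indep_subsets[of X]]) blast
  moreover have "?S \<noteq> {}" using assms by blast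
  ultimately have "Max (card ` ?S) \<in> card ` ?S" by (intro Max_in) blast+
  then obtain J where J: "J \<in> ?S" and max: "card J = Max (card ` ?S)" by fastforce
  have le: "card K \<le> card J" if "K \<in> ?S" for K
    unfolding max by (intro Max_ge finite_imageI imageI \<open>finite ?S\<close> that)
  obtain K where K: "indep M K" "K \<subseteq> X" "card K = rk M X" using ex_indep_card_rk by blast
  have "\<not> card J < card K"
  proof
    assume "card J < card K"
    then obtain e where e: "e \<in> K - J" "indep M (insert e J)" using indep_augment J K by blast
    then have "card (insert e J) \<le> card J" using J K by (intro le) auto
    with e J show False by (simp add: finite_indep)
  qed
  moreover have "card J \<le> rk M X" using J by (intro card_le_rk) auto
  ultimately show ?thesis using that[of J] J K(3) by simp
qed

lemma rk_mono: "X \<subseteq> Y \<Longrightarrow> rk M X \<le> rk M Y"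
  by (rule rk_leI) (auto intro: card_le_rk)

lemma rk_le_card: "finite X \<Longrightarrow> rk M X \<le> card X"
  by (rule rk_leI) (auto intro: card_mono)

lemma rk_empty [simp]: "rk M {} = 0"
  using rk_le_card[of "{}"] by simp

lemma indep_iff_rk: "indep M X \<longleftrightarrow> X \<subseteq> ground M \<and> rk M X = card X"
proof
  assume X: "indep M X"
  then show "X \<subseteq> ground M \<and> rk M X = card X"
    using rk_le_card[OF finite_indep[OF X]] card_le_rk[OF X order_refl] indep_subset_ground by auto
next
  assume X: "X \<subseteq> ground M \<and> rk M X = card X"
  then have "finite X" using finite_ground finite_subset by blast
  moreover obtain I where "indep M I" "I \<subseteq> X" "card I = rk M X" using ex_indep_card_rk by blast
  ultimately show "indep M X" using X card_subset_eq[of X I] by simp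
qed

text \<open>Extend a maximal independent subset of \<open>X \<inter> Y\<close> first within
  \<open>X\<close>, then within \<open>X \<union> Y\<close>. The result \<open>K\<close> meets
  \<open>X\<close> and \<open>Y\<close> in independent sets, whose sizes are compared by
  inclusion-exclusion.\<close>

lemma rk_submodular: "rk M (X \<union> Y) + rk M (X \<inter> Y) \<le> rk M X + rk M Y"
proof -
  obtain I where I: "indep M I" "I \<subseteq> X \<inter> Y" "card I = rk M (X \<inter> Y)"
    using ex_indep_card_rk by blast
  obtain J where J: "indep M J" "I \<subseteq> J" "J \<subseteq> X" "card J = rk M X"
    using indep_extend[of I X] I by blast
  obtain K where K: "indep M K" "J \<subseteq> K" "K \<subseteq> X \<union> Y" "card K = rk M (X \<union> Y)"
    using indep_extend[of J "X \<union> Y"] J by blast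
  note fin = finite_indep[OF K(1)]
  have "card K + card (K \<inter> X \<inter> Y) = card (K \<inter> X) + card (K \<inter> Y)"
  proof -
    have "K = (K \<inter> X) \<union> (K \<inter> Y)" "(K \<inter> X) \<inter> (K \<inter> Y) = K \<inter> X \<inter> Y" using K by auto
    then show ?thesis using card_Un_Int[of "K \<inter> X" "K \<inter> Y"] fin by simp
  qed
  moreover have "card (K \<inter> X) \<le> rk M X" "card (K \<inter> Y) \<le> rk M Y"
    using K(1) by (auto intro: card_le_rk indep_subset)
  moreover have "card I \<le> card (K \<inter> X \<inter> Y)"
    using I J K fin by (intro card_mono) auto
  ultimately show ?thesis using I K by linarith
qed

lemma rk_le_insert: "rk M X \<le> rk M (insert e X)"
  by (intro rk_mono) auto

lemma rk_insert_le: "rk M (insert e X) \<le> Suc (rk M X)"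
  using rk_submodular[of "{e}" X] rk_le_card[of "{e}"] by simp

text \<open>What is spanned by \<open>X\<close> is spanned by every larger set: submodularity for
  \<open>insert e X\<close> and \<open>Y\<close>.\<close>

lemma rk_insert_eq_mono:
  assumes "rk M (insert e X) = rk M X" "X \<subseteq> Y"
  shows "rk M (insert e Y) = rk M Y"
proof -
  have "rk M (insert e Y) + rk M (insert e X \<inter> Y) \<le> rk M (insert e X) + rk M Y"
    using rk_submodular[of "insert e X" Y] assms(2) by (simp add: sup.absorb2 insert_absorb)
  moreover have "rk M X \<le> rk M (insert e X \<inter> Y)" using assms(2) by (intro rk_mono) auto
  moreover have "rk M Y \<le> rk M (insert e Y)" by (intro rk_mono) auto
  ultimately show ?thesis using assms(1) by linarith
qed

lemma rk_Un_eq: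
  assumes "finite S" "\<And>e. e \<in> S \<Longrightarrow> rk M (insert e X) = rk M X"
  shows "rk M (X \<union> S) = rk M X"
  using assms
proof (induction S rule: finite_induct)
  case (insert e S)
  have "rk M (insert e (X \<union> S)) = rk M (X \<union> S)"
    by (rule rk_insert_eq_mono[OF insert.prems]) auto
  also have "\<dots> = rk M X" by (rule insert.IH) (rule insert.prems, blast)
  finally show ?case by simp
qed simp

section \<open>Closures and flats\<close>

lemma closure_of_subset_ground: "closure_of M X \<subseteq> ground M"
  by (auto simp: closure_of_def)

lemma subset_closure_of: "X \<subseteq> ground M \<Longrightarrow> X \<subseteq> closure_of M X"
  by (auto simp: closure_of_def insert_absorb)

lemma rk_closure_of:
  assumes "X \<subseteq> ground M"
  shows "rk M (closure_of M X) = rk M X"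
proof -
  have "rk M (X \<union> closure_of M X) = rk M X"
    by (rule rk_Un_eq) (auto simp: closure_of_def finite_ground)
  then show ?thesis using subset_closure_of[OF assms] by (simp add: sup.absorb2)
qed

lemma rk_insert_flat: "F \<in> flats M \<Longrightarrow> e \<in> ground M - F \<Longrightarrow> rk M (insert e F) = Suc (rk M F)"
  using rk_insert_le[of e F] unfolding flats_def by (simp add: le_antisym Suc_leI)

lemma closure_of_in_flats:
  assumes "X \<subseteq> ground M"
  shows "closure_of M X \<in> flats M"
  unfolding flats_def
proof (intro CollectI conjI ballI)
  fix e assume e: "e \<in> ground M - closure_of M X"
  then have "rk M X \<noteq> rk M (insert e X)" by (auto simp: closure_of_def)
  then have "rk M X < rk M (insert e X)" using rk_le_insert[of X e] by auto
  also have "\<dots> \<le> rk M (insert e (closure_of M X))"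
    using subset_closure_of[OF assms] by (intro rk_mono) auto
  finally show "rk M (closure_of M X) < rk M (insert e (closure_of M X))"
    by (simp add: rk_closure_of[OF assms])
qed (rule closure_of_subset_ground)

lemma closure_of_subset_flat:
  assumes "F \<in> flats M" "X \<subseteq> F"
  shows "closure_of M X \<subseteq> F"
proof
  fix e assume e: "e \<in> closure_of M X"
  then have "e \<in> ground M" "rk M (insert e X) = rk M X" by (simp_all add: closure_of_def)
  moreover from this have "rk M (insert e F) = rk M F" using assms(2) rk_insert_eq_mono by blast
  ultimately show "e \<in> F" using rk_insert_flat[OF assms(1), of e] by auto
qed

lemma rk_flats_strict_mono:
  assumes "F \<in> flats M" "F \<subset> X" "X \<subseteq> ground M"
  shows "rk M F < rk M X"
proof -
  obtain e where e: "e \<in> X - F" using assms by blast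
  then have "rk M F < rk M (insert e F)" using assms by (auto simp: flats_def)
  also have "\<dots> \<le> rk M X" using e assms by (intro rk_mono) auto
  finally show ?thesis .
qed

section \<open>Bases, restriction and contraction\<close>

lemma basis_iff: "basis M B \<longleftrightarrow> indep M B \<and> card B = rank M"
proof
  assume B: "basis M B"
  then obtain J where "indep M J" "B \<subseteq> J" "card J = rank M"
    using indep_extend[of B "ground M"] indep_subset_ground by (auto simp: basis_def)
  with B show "indep M B \<and> card B = rank M" by (auto simp: basis_def)
next
  assume B: "indep M B \<and> card B = rank M"
  have "X = B" if "indep M X" "B \<subseteq> X" for X
    using that B card_le_rk[of X "ground M"] indep_subset_ground[of X] finite_indep[of X]
    by (metis card_seteq)
  with B show "basis M B" by (simp add: basis_def)
qed

lemma restriction_ground: "restriction M (ground M) = M"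
  using indep_subset_ground by (auto simp: restriction_def fun_eq_iff intro!: matroid.equality)

lemma finite_matroid_restriction:
  assumes "A \<subseteq> ground M"
  shows "finite_matroid (restriction M A)"
proof
  show "finite (ground (restriction M A))" using assms finite_ground by (auto intro: finite_subset)
  show "indep (restriction M A) {}" using indep_empty by simp
  show "\<exists>e\<in>Y - X. indep (restriction M A) (insert e X)"
    if "indep (restriction M A) X" "indep (restriction M A) Y" "card X < card Y" for X Y
    using that indep_augment[of X Y] by auto
qed (auto intro: indep_subset)

lemma basis_restriction_iff:
  assumes "A \<subseteq> ground M"
  shows "basis (restriction M A) B \<longleftrightarrow> indep M B \<and> B \<subseteq> A \<and> card B = rk M A"
  using finite_matroid.basis_iff[OF finite_matroid_restriction[OF assms]]
  by (simp add: rk_restriction conj_assoc)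

text \<open>As \<open>B\<close> spans \<open>A\<close>, the sets \<open>X \<union> B\<close> and
  \<open>X \<union> A\<close> have equal rank. Independence in the contraction thus becomes a rank
  condition free of the chosen basis.\<close>

lemma indep_Un_basis_iff:
  assumes A: "A \<subseteq> ground M" and B: "indep M B" "B \<subseteq> A" "card B = rk M A"
    and X: "X \<subseteq> ground M - A"
  shows "indep M (X \<union> B) \<longleftrightarrow> rk M (X \<union> A) = card X + rk M A"
proof -
  have finA: "finite A" and finX: "finite X" using A X finite_ground by (auto intro: finite_subset)
  have "rk M (insert e B) = rk M B" if "e \<in> A" for e
    using that B rk_mono[of "insert e B" A] rk_le_insert[of B e] by (auto simp: indep_iff_rk)
  then have "rk M (insert e (X \<union> B)) = rk M (X \<union> B)" if "e \<in> A" for e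
    using that by (blast intro!: rk_insert_eq_mono[of e B "X \<union> B"])
  then have "rk M ((X \<union> B) \<union> A) = rk M (X \<union> B)" using finA by (intro rk_Un_eq)
  moreover have "(X \<union> B) \<union> A = X \<union> A" using B by auto
  moreover have "card (X \<union> B) = card X + rk M A"
    using B X finX finite_indep[OF B(1)] by (subst card_Un_disjoint) auto
  ultimately show ?thesis using A B X by (auto simp: indep_iff_rk)
qed

lemma indep_contraction_iff:
  assumes A: "A \<subseteq> ground M"
  shows "indep (contraction M A) X \<longleftrightarrow> X \<subseteq> ground M - A \<and> rk M (X \<union> A) = card X + rk M A"
proof -
  obtain B where "indep M B" "B \<subseteq> A" "card B = rk M A" using ex_indep_card_rk by blast
  then show ?thesis
    unfolding contraction_def basis_restriction_iff[OF A] using indep_Un_basis_iff[OF A] by auto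
qed

text \<open>With one basis \<open>B\<close> of \<open>A\<close> fixed, augmentation is inherited
  from \<open>M\<close> for \<open>X \<union> B\<close> and \<open>Y \<union> B\<close>: the new
  element avoids \<open>B\<close> and hence comes from \<open>Y\<close>.\<close>

lemma finite_matroid_contraction:
  assumes A: "A \<subseteq> ground M"
  shows "finite_matroid (contraction M A)"
proof -
  obtain B where B: "indep M B" "B \<subseteq> A" "card B = rk M A" using ex_indep_card_rk by blast
  have iff: "indep (contraction M A) X \<longleftrightarrow> X \<subseteq> ground M - A \<and> indep M (X \<union> B)" for X
    using indep_Un_basis_iff[OF A B] indep_contraction_iff[OF A] by blast
  show ?thesis
  proof
    show "finite (ground (contraction M A))" using finite_ground by simp
    show "X \<subseteq> ground (contraction M A)" if "indep (contraction M A) X" for X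
      using that iff by simp
    show "indep (contraction M A) {}" using iff B by simp
    show "indep (contraction M A) X" if "indep (contraction M A) Y" "X \<subseteq> Y" for X Y
      using that indep_subset[of "Y \<union> B" "X \<union> B"] by (auto simp: iff)
    show "\<exists>e\<in>Y - X. indep (contraction M A) (insert e X)"
      if "indep (contraction M A) X" "indep (contraction M A) Y" "card X < card Y" for X Y
    proof -
      have X: "X \<subseteq> ground M - A" "indep M (X \<union> B)" and Y: "Y \<subseteq> ground M - A" "indep M (Y \<union> B)"
        using that iff by auto
      have "card (X \<union> B) = card X + card B" "card (Y \<union> B) = card Y + card B"
        using X(1) Y(1) B(2) finite_indep[OF X(2)] finite_indep[OF Y(2)]
        by (intro card_Un_disjoint; auto)+
      with that(3) obtain e where "e \<in> (Y \<union> B) - (X \<union> B)" "indep M (insert e (X \<union> B))"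
        using indep_augment[OF X(2) Y(2)] by auto
      then show ?thesis using X Y by (intro bexI[of _ e]) (auto simp: iff)
    qed
  qed
qed

lemma rk_contraction:
  assumes A: "A \<subseteq> ground M" and X: "X \<subseteq> ground M - A"
  shows "rk (contraction M A) X = rk M (X \<union> A) - rk M A"
proof (rule antisym)
  interpret C: finite_matroid "contraction M A" by (rule finite_matroid_contraction[OF A])
  show "rk (contraction M A) X \<le> rk M (X \<union> A) - rk M A"
  proof (rule C.rk_leI)
    fix I assume "indep (contraction M A) I" "I \<subseteq> X"
    then show "card I \<le> rk M (X \<union> A) - rk M A"
      using rk_mono[OF Un_mono[OF _ order_refl, of I X A]] by (simp add: indep_contraction_iff[OF A])
  qed
  obtain B where B: "indep M B" "B \<subseteq> A" "card B = rk M A" using ex_indep_card_rk by blast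
  obtain J where J: "indep M J" "B \<subseteq> J" "J \<subseteq> X \<union> A" "card J = rk M (X \<union> A)"
    using indep_extend[of B "X \<union> A"] B by blast
  \<comment> \<open>The independent set \<open>J\<close> cannot meet \<open>A\<close> in more than
    the basis \<open>B\<close>, so what it has beyond \<open>B\<close> lies in \<open>X\<close> and
    is independent in the contraction.\<close>
  have "card (J \<inter> A) \<le> card B" using B J by (auto intro!: card_le_rk intro: indep_subset)
  then have "B = J \<inter> A"
    using B J finite_indep[OF J(1)] by (intro card_seteq) auto
  then have sub: "J - B \<subseteq> X" and Un: "(J - B) \<union> B = J" using J by auto
  have "J - B \<subseteq> ground M - A" using sub X by blast
  then have "indep (contraction M A) (J - B)"
    using indep_Un_basis_iff[OF A B, of "J - B"] J(1) unfolding indep_contraction_iff[OF A] Un by blast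
  then have "card (J - B) \<le> rk (contraction M A) X" using sub by (rule C.card_le_rk)
  then show "rk M (X \<union> A) - rk M A \<le> rk (contraction M A) X"
    using B J by (simp add: card_Diff_subset finite_indep)
qed

section \<open>Flats of restrictions, contractions and deletions\<close>

text \<open>An element outside the flat \<open>F\<close> is not spanned by any subset of
  \<open>F\<close>, so the flat condition only has to be tested on elements of
  \<open>F\<close>.\<close>

lemma flats_restriction:
  assumes F: "F \<in> flats M"
  shows "flats (restriction M F) = {G \<in> flats M. G \<subseteq> F}"
proof -
  have "(\<forall>e\<in>ground M - G. rk M G < rk M (insert e G)) \<longleftrightarrow>
      (\<forall>e\<in>F - G. rk (restriction M F) G < rk (restriction M F) (insert e G))" if G: "G \<subseteq> F" for G
  proof -
    have outside: "rk M G < rk M (insert e G)" if "e \<in> ground M - F" for e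
      using rk_insert_flat[OF F that] rk_insert_eq_mono[OF _ G, of e] rk_le_insert[of G e]
      by (metis le_neq_implies_less n_not_Suc_n)
    have "rk (restriction M F) (insert e G) = rk M (insert e G)" if "e \<in> F" for e
      using that G by (simp add: rk_restriction inf.absorb1)
    moreover have "rk (restriction M F) G = rk M G" using G by (simp add: rk_restriction inf.absorb1)
    ultimately show ?thesis using outside flats_subset_ground[OF F] by auto
  qed
  then show ?thesis
    using flats_subset_ground[OF F] unfolding flats_def by auto
qed

lemma flats_contraction:
  assumes A: "A \<subseteq> ground M"
  shows "flats (contraction M A) = (\<lambda>F. F - A) ` {F \<in> flats M. A \<subseteq> F}"
proof -
  have iff: "X \<in> flats (contraction M A) \<longleftrightarrow> X \<union> A \<in> flats M" if X: "X \<subseteq> ground M - A" for X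
  proof -
    have "rk (contraction M A) X < rk (contraction M A) (insert e X) \<longleftrightarrow>
        rk M (X \<union> A) < rk M (insert e (X \<union> A))" if "e \<in> ground M - (X \<union> A)" for e
    proof -
      have "rk M A \<le> rk M (X \<union> A)" "rk M (X \<union> A) \<le> rk M (insert e (X \<union> A))"
        by (auto intro: rk_mono)
      then show ?thesis using that X by (simp add: rk_contraction[OF A]) linarith
    qed
    moreover have "ground M - A - X = ground M - (X \<union> A)" by blast
    ultimately show ?thesis using X A unfolding flats_def by auto
  qed
  show ?thesis
  proof (intro equalityI subsetI)
    fix X assume X: "X \<in> flats (contraction M A)"
    then have "X \<subseteq> ground M - A" using flats_subset_ground by fastforce
    with X iff have "X \<union> A \<in> flats M" "X = (X \<union> A) - A" by auto
    then show "X \<in> (\<lambda>F. F - A) ` {F \<in> flats M. A \<subseteq> F}" by blast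
  next
    fix X assume "X \<in> (\<lambda>F. F - A) ` {F \<in> flats M. A \<subseteq> F}"
    then obtain F where F: "F \<in> flats M" "A \<subseteq> F" "X = F - A" by blast
    then have "X \<subseteq> ground M - A" "X \<union> A = F" using flats_subset_ground by auto
    with iff F show "X \<in> flats (contraction M A)" by simp
  qed
qed

text \<open>A flat of the deletion is recovered from its closure in \<open>M\<close>, which can add
  only \<open>i\<close>. Conversely, an element outside a flat \<open>F\<close> is not spanned by
  \<open>F\<close>, still less by \<open>F - {i}\<close>.\<close>

lemma flats_deletion:
  "flats (deletion M {i}) = (\<lambda>F. F - {i}) ` flats M"
proof (intro equalityI subsetI)
  fix X assume X: "X \<in> flats (deletion M {i})"
  then have sub: "X \<subseteq> ground M - {i}" by (auto simp: flats_def)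
  have "closure_of M X - {i} \<subseteq> X"
  proof
    fix e assume e: "e \<in> closure_of M X - {i}"
    show "e \<in> X"
    proof (rule ccontr)
      assume "e \<notin> X"
      with e have "e \<in> ground (deletion M {i}) - X" by (auto simp: closure_of_def)
      with X have "rk (deletion M {i}) X < rk (deletion M {i}) (insert e X)"
        unfolding flats_def by blast
      then show False using e sub
        by (auto simp: deletion_def rk_restriction closure_of_def inf.absorb1 insert_absorb)
    qed
  qed
  then have "X = closure_of M X - {i}" using subset_closure_of[of X] sub by blast
  then show "X \<in> (\<lambda>F. F - {i}) ` flats M" using closure_of_in_flats[of X] sub by blast
next
  fix X assume "X \<in> (\<lambda>F. F - {i}) ` flats M"
  then obtain F where F: "F \<in> flats M" "X = F - {i}" by blast
  have sub: "X \<subseteq> ground M - {i}" using F flats_subset_ground by auto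
  have "rk M X < rk M (insert e X)" if e: "e \<in> ground M - {i} - X" for e
  proof -
    have "e \<in> ground M - F" using e F by blast
    then have "rk M (insert e F) \<noteq> rk M F" using rk_insert_flat[OF F(1)] by simp
    then have "rk M (insert e X) \<noteq> rk M X" using rk_insert_eq_mono[of e X F] F by blast
    then show ?thesis using rk_le_insert[of X e] by auto
  qed
  then show "X \<in> flats (deletion M {i})"
    using sub unfolding flats_def
    by (auto simp: deletion_def rk_restriction inf.absorb1)
qed

lemma coloop_iff_rk: "coloop M i \<longleftrightarrow> i \<in> ground M \<and> rk M (ground M - {i}) < rank M"
proof -
  have "(\<forall>B. basis M B \<longrightarrow> i \<in> B) \<longleftrightarrow> rk M (ground M - {i}) < rank M"
  proof
    assume B: "\<forall>B. basis M B \<longrightarrow> i \<in> B"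
    obtain J where J: "indep M J" "J \<subseteq> ground M - {i}" "card J = rk M (ground M - {i})"
      using ex_indep_card_rk by blast
    then have "card J \<noteq> rank M" using B basis_iff by blast
    then show "rk M (ground M - {i}) < rank M"
      using J rk_mono[of "ground M - {i}" "ground M"] by auto
  next
    assume *: "rk M (ground M - {i}) < rank M"
    show "\<forall>B. basis M B \<longrightarrow> i \<in> B"
    proof (intro allI impI, rule ccontr)
      fix B assume B: "basis M B" "i \<notin> B"
      then have "B \<subseteq> ground M - {i}" using indep_subset_ground[of B] by (auto simp: basis_iff)
      then have "card B \<le> rk M (ground M - {i})" "card B = rank M"
        using B card_le_rk[of B "ground M - {i}"] by (simp_all add: basis_iff)
      with * show False by simp
    qed
  qed
  then show ?thesis by (simp add: coloop_def)
qed

lemma coloop_iff_flat: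
  assumes "i \<in> ground M"
  shows "coloop M i \<longleftrightarrow> ground M - {i} \<in> flats M"
proof -
  have "ground M - (ground M - {i}) = {i}" "insert i (ground M - {i}) = ground M" using assms by auto
  then show ?thesis using assms by (simp add: coloop_iff_rk flats_def)
qed

lemma empty_in_flats: "loopless M \<Longrightarrow> {} \<in> flats M"
  by (auto simp: flats_def loopless_def indep_iff_rk)

end

text \<open>Independent sets are those whose rank equals their size, so identities between minors
  reduce to rank computations.\<close>

lemma matroid_eqI:
  assumes "finite_matroid M" "finite_matroid N" "ground M = ground N"
    and "\<And>X. X \<subseteq> ground M \<Longrightarrow> rk M X = rk N X"
  shows "M = N"
proof -
  have "indep M X \<longleftrightarrow> indep N X" for X
    using finite_matroid.indep_iff_rk[OF assms(1)] finite_matroid.indep_iff_rk[OF assms(2)] assms(3,4)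
    by auto
  then show ?thesis using assms(3) by (intro matroid.equality) auto
qed

section \<open>Minors on intervals\<close>

context finite_matroid
begin

lemma contraction_empty: "contraction M {} = M"
  using finite_matroid_axioms
  by (intro matroid_eqI finite_matroid_contraction) (auto simp: rk_contraction)

context
  fixes A B
  assumes A: "A \<subseteq> B" and B: "B \<subseteq> ground M"
begin

lemma finite_matroid_minor: "finite_matroid (minor M A B)"
  unfolding minor_def using A B
  by (intro finite_matroid.finite_matroid_contraction finite_matroid_restriction) simp_all

lemma rk_minor:
  assumes "X \<subseteq> B - A"
  shows "rk (minor M A B) X = rk M (X \<union> A) - rk M A"
proof -
  have "(X \<union> A) \<inter> B = X \<union> A" "A \<inter> B = A" using assms A by auto
  then show ?thesis
    unfolding minor_def using A assms
    by (simp add: finite_matroid.rk_contraction[OF finite_matroid_restriction[OF B]] rk_restriction)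
qed

lemma rank_minor: "rank (minor M A B) = rk M B - rk M A"
  using A by (simp add: rk_minor Un_absorb2)

end

lemma minor_minor:
  assumes "A \<subseteq> C" "C \<subseteq> D" "D \<subseteq> B" "B \<subseteq> ground M"
  shows "minor (minor M A B) (C - A) (D - A) = minor M C D"
proof (rule matroid_eqI)
  have AB: "A \<subseteq> B" using assms by blast
  interpret N: finite_matroid "minor M A B" using finite_matroid_minor[OF AB assms(4)] .
  have sub: "C - A \<subseteq> D - A" "D - A \<subseteq> ground (minor M A B)" "D \<subseteq> ground M" using assms by auto
  show "finite_matroid (minor (minor M A B) (C - A) (D - A))"
    by (rule N.finite_matroid_minor[OF sub(1,2)])
  show "finite_matroid (minor M C D)" by (rule finite_matroid_minor[OF assms(2) sub(3)])
  show "ground (minor (minor M A B) (C - A) (D - A)) = ground (minor M C D)" using assms by auto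
  fix X assume X: "X \<subseteq> ground (minor (minor M A B) (C - A) (D - A))"
  then have X': "X \<subseteq> D - A - (C - A)" by simp
  have "X \<union> (C - A) \<union> A = X \<union> C" "C - A \<union> A = C" "X \<subseteq> D - C" "X \<union> (C - A) \<subseteq> B - A" "C - A \<subseteq> B - A"
    using X' assms by auto
  moreover have "rk M A \<le> rk M C" using assms by (intro rk_mono)
  ultimately show "rk (minor (minor M A B) (C - A) (D - A)) X = rk (minor M C D) X"
    using N.rk_minor[OF sub(1,2) X'] rk_minor[OF AB assms(4), of "X \<union> (C - A)"]
      rk_minor[OF AB assms(4), of "C - A"] rk_minor[OF assms(2) sub(3), of X] by simp
qed

lemma minor_ground: "minor M A (ground M) = contraction M A"
  by (simp add: minor_def restriction_ground)

lemma minor_empty: "B \<subseteq> ground M \<Longrightarrow> minor M {} B = restriction M B"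
  unfolding minor_def
  by (rule finite_matroid.contraction_empty) (rule finite_matroid_restriction)

lemma flats_minor:
  assumes "B \<in> flats M" "A \<subseteq> B"
  shows "flats (minor M A B) = (\<lambda>F. F - A) ` {F \<in> flats M. A \<subseteq> F \<and> F \<subseteq> B}"
proof -
  interpret R: finite_matroid "restriction M B"
    using flats_subset_ground[OF assms(1)] by (rule finite_matroid_restriction)
  show ?thesis
    unfolding minor_def using R.flats_contraction[of A] assms
    by (simp add: flats_restriction) (metis (no_types, lifting) Collect_cong)
qed

text \<open>Contracting a flat creates no loops, as each further element raises its rank.\<close>

lemma loopless_minor:
  assumes A: "A \<in> flats M" and B: "A \<subseteq> B" "B \<subseteq> ground M"
  shows "loopless (minor M A B)"
  unfolding loopless_def
proof
  fix e assume "e \<in> ground (minor M A B)"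
  then have e: "e \<in> B - A" by simp
  then have "rk M (insert e A) = Suc (rk M A)" using A B by (intro rk_insert_flat) auto
  then show "indep (minor M A B) {e}"
    using e rk_minor[OF B, of "{e}"]
    by (simp add: finite_matroid.indep_iff_rk[OF finite_matroid_minor[OF B]])
qed

end


section \<open>Existence and uniqueness of the Kazhdan--Lusztig polynomials\<close>

lemma loopless_matroidsD:
  assumes "N \<in> loopless_matroids"
  shows "finite_matroid N" "loopless N"
  using assms by (simp_all add: loopless_matroids_def)

lemma minor_in_loopless_matroids:
  assumes "N \<in> loopless_matroids" "A \<in> flats N" "A \<subseteq> B" "B \<subseteq> ground N"
  shows "minor N A B \<in> loopless_matroids"
  using assms finite_matroid.finite_matroid_minor[of N] finite_matroid.loopless_minor[of N]
  by (auto simp: loopless_matroids_def)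

lemma restriction_in_loopless_matroids:
  assumes "N \<in> loopless_matroids" "B \<subseteq> ground N"
  shows "restriction N B \<in> loopless_matroids"
  using assms finite_matroid.finite_matroid_restriction[of N B]
  by (auto simp: loopless_matroids_def loopless_def)

lemma contraction_in_loopless_matroids:
  assumes "N \<in> loopless_matroids" "A \<in> flats N"
  shows "contraction N A \<in> loopless_matroids"
  using minor_in_loopless_matroids[OF assms flats_subset_ground[OF assms(2)] order_refl]
    finite_matroid.minor_ground[OF loopless_matroidsD(1)[OF assms(1)]] by simp

text \<open>Common scheme for both families of polynomials. \<open>T\<close> stands for the defining
  sum without the term that is the value at \<open>N\<close> itself; it depends on smaller ranks
  only. Recursion on the rank gives existence by \<open>ex_palindromic_completion\<close>, and
  induction gives uniqueness by \<open>palindromic_low_degree_eq_0\<close>.\<close>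

lemma ex1_palindromic_assignment:
  fixes T :: "('a matroid \<Rightarrow> int poly) \<Rightarrow> 'a matroid \<Rightarrow> int poly"
  assumes cong: "\<And>P P' N. N \<in> loopless_matroids \<Longrightarrow>
        (\<And>N'. N' \<in> loopless_matroids \<Longrightarrow> rank N' < rank N \<Longrightarrow> P N' = P' N') \<Longrightarrow> T P N = T P' N"
    and deg: "\<And>P N. N \<in> loopless_matroids \<Longrightarrow>
        (\<And>N'. N' \<in> loopless_matroids \<Longrightarrow> rank N' < rank N \<Longrightarrow> degree (P N') \<le> rank N') \<Longrightarrow>
        degree (T P N) \<le> rank N"
    and zero: "\<And>P N. N \<in> loopless_matroids \<Longrightarrow> rank N = 0 \<Longrightarrow> T P N = 0"
  shows "\<exists>!P. P \<in> extensional loopless_matroids \<and> (\<forall>N\<in>loopless_matroids.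
      (rank N = 0 \<longrightarrow> P N = 1) \<and> (rank N > 0 \<longrightarrow> 2 * degree (P N) < rank N) \<and>
      palindromic (rank N) (P N + T P N))"
proof (rule ex_ex1I)
  \<comment> \<open>\<open>C P N r\<close> says that \<open>r\<close> is an admissible value at
    \<open>N\<close> when \<open>P\<close> supplies the values at smaller rank. Outside the class it
    forces \<open>undefined\<close>, as \<open>extensional\<close> demands.\<close>
  define C where "C P N r \<longleftrightarrow> (if N \<in> loopless_matroids then
      (rank N = 0 \<longrightarrow> r = 1) \<and> (rank N > 0 \<longrightarrow> 2 * degree r < rank N) \<and>
      palindromic (rank N) (r + T P N) else r = undefined)" for P N and r :: "int poly"
  have "\<exists>P. \<forall>N. C P N (P N)"
  proof (rule dependent_wf_choice[of "measure (\<lambda>N :: 'a matroid. rank N)"])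
    show "wf (measure (\<lambda>N :: 'a matroid. rank N))" by simp
    show "C f N r = C g N r" if "\<And>N'. (N', N) \<in> measure (\<lambda>N. rank N) \<Longrightarrow> f N' = g N'"
      for f g :: "'a matroid \<Rightarrow> int poly" and N r
      using cong[of N f g] that by (auto simp: C_def)
    show "\<exists>r. C f N r" if *: "\<And>N'. (N', N) \<in> measure (\<lambda>N. rank N) \<Longrightarrow> C f N' (f N')"
      for f :: "'a matroid \<Rightarrow> int poly" and N
    proof (cases "N \<in> loopless_matroids \<and> rank N > 0")
      case True
      have "degree (T f N) \<le> rank N"
      proof (rule deg)
        fix N' :: "'a matroid" assume "N' \<in> loopless_matroids" "rank N' < rank N"
        then show "degree (f N') \<le> rank N'"
          using *[of N'] by (cases "rank N' = 0") (auto simp: C_def)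
      qed (use True in simp)
      from ex_palindromic_completion[OF this] True show ?thesis by (auto simp: C_def)
    next
      case False
      then show ?thesis
        by (intro exI[of _ "if N \<in> loopless_matroids then 1 else undefined"])
          (auto simp: C_def zero palindromic_iff_coeff)
    qed
  qed
  then obtain P where P: "\<And>N. C P N (P N)" by blast
  have "P \<in> extensional loopless_matroids"
    using P by (auto simp: C_def extensional_def split: if_splits)
  then show "\<exists>P. P \<in> extensional loopless_matroids \<and> (\<forall>N\<in>loopless_matroids.
      (rank N = 0 \<longrightarrow> P N = 1) \<and> (rank N > 0 \<longrightarrow> 2 * degree (P N) < rank N) \<and>
      palindromic (rank N) (P N + T P N))"
    using P by (intro exI[of _ P] conjI ballI) (simp_all add: C_def split: if_splits)
next
  fix P P'
  assume P: "P \<in> extensional loopless_matroids \<and> (\<forall>N\<in>loopless_matroids.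
      (rank N = 0 \<longrightarrow> P N = 1) \<and> (rank N > 0 \<longrightarrow> 2 * degree (P N) < rank N) \<and>
      palindromic (rank N) (P N + T P N))"
    and P': "P' \<in> extensional loopless_matroids \<and> (\<forall>N\<in>loopless_matroids.
      (rank N = 0 \<longrightarrow> P' N = 1) \<and> (rank N > 0 \<longrightarrow> 2 * degree (P' N) < rank N) \<and>
      palindromic (rank N) (P' N + T P' N))"
  have "P N = P' N" if "N \<in> loopless_matroids" for N
    using that
  proof (induction "rank N" arbitrary: N rule: less_induct)
    case less
    then have T: "T P N = T P' N" by (intro cong)
    show ?case
    proof (cases "rank N = 0")
      case False
      with P P' less.prems have "palindromic (rank N) ((P N + T P N) - (P' N + T P' N))"
        by (intro palindromic_diff) auto
      then have "palindromic (rank N) (P N - P' N)" by (simp add: T)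
      moreover have "2 * degree (P N - P' N) < rank N"
        using degree_diff_le_max[of "P N" "P' N"] False P P' less.prems by fastforce
      ultimately show ?thesis using palindromic_low_degree_eq_0 by fastforce
    qed (use P P' less.prems in auto)
  qed
  with P P' show "P = P'" by (intro extensionalityI[of P loopless_matroids P']) auto
qed

text \<open>The empty flat contributes \<open>P N\<close> itself to \<open>Z_sum\<close>; every
  other flat has positive rank, so its contraction has smaller rank.\<close>

lemma ex1_KL_assignment: "\<exists>!P. KL_assignment (P :: 'a matroid \<Rightarrow> int poly)"
proof -
  define T where "T P N = (\<Sum>F\<in>flats N - {{}}. monom 1 (rk N F) * P (contraction N F))"
    for P :: "'a matroid \<Rightarrow> int poly" and N
  have Z: "Z_sum P N = P N + T P N" if "N \<in> loopless_matroids" for P N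
  proof -
    interpret finite_matroid N using loopless_matroidsD(1)[OF that] .
    show ?thesis
      unfolding Z_sum_def T_def
      by (subst sum.remove[OF finite_flats empty_in_flats[OF loopless_matroidsD(2)[OF that]]])
        (simp add: contraction_empty)
  qed
  have smaller: "contraction N F \<in> loopless_matroids" "rank (contraction N F) + rk N F = rank N"
      "rk N F > 0"
    if N: "N \<in> loopless_matroids" and F: "F \<in> flats N - {{}}" for N and F :: "'a set"
  proof -
    interpret finite_matroid N using loopless_matroidsD(1)[OF N] .
    have F': "F \<subseteq> ground N" "F \<in> flats N" using F flats_subset_ground by auto
    show "contraction N F \<in> loopless_matroids" by (rule contraction_in_loopless_matroids[OF N F'(2)])
    have "rk N F \<le> rank N" using F' by (intro rk_mono)
    then show "rank (contraction N F) + rk N F = rank N"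
      using F' by (simp add: rk_contraction Un_absorb2)
    show "rk N F > 0"
      using rk_flats_strict_mono[OF empty_in_flats[OF loopless_matroidsD(2)[OF N]], of F] F F'
      by (auto simp: psubset_eq)
  qed
  have "\<exists>!P. P \<in> extensional loopless_matroids \<and> (\<forall>N\<in>loopless_matroids.
      (rank N = 0 \<longrightarrow> P N = 1) \<and> (rank N > 0 \<longrightarrow> 2 * degree (P N) < rank N) \<and>
      palindromic (rank N) (P N + T P N))"
  proof (rule ex1_palindromic_assignment)
    fix N :: "'a matroid" and P P' :: "'a matroid \<Rightarrow> int poly" assume N: "N \<in> loopless_matroids"
    { assume P: "\<And>N'. N' \<in> loopless_matroids \<Longrightarrow> rank N' < rank N \<Longrightarrow> P N' = P' N'"
      have "P (contraction N F) = P' (contraction N F)" if "F \<in> flats N - {{}}" for F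
        using P[OF smaller(1)[OF N that]] smaller(2,3)[OF N that] by linarith
      then show "T P N = T P' N" unfolding T_def by (intro sum.cong) simp_all }
    { assume P: "\<And>N'. N' \<in> loopless_matroids \<Longrightarrow> rank N' < rank N \<Longrightarrow> degree (P N') \<le> rank N'"
      have "degree (monom 1 (rk N F) * P (contraction N F)) \<le> rank N" if "F \<in> flats N - {{}}" for F
        using P[OF smaller(1)[OF N that]] smaller(2,3)[OF N that]
          degree_mult_le[of "monom 1 (rk N F)" "P (contraction N F)"] degree_monom_le[of 1 "rk N F"]
        by (simp add: degree_monom_eq)
      then show "degree (T P N) \<le> rank N" unfolding T_def
        by (intro degree_sum_le)
          (use finite_matroid.finite_flats[OF loopless_matroidsD(1)[OF N]] in auto) }
    assume "rank N = 0"
    then have "flats N - {{}} = {}" using smaller(2,3)[OF N] by fastforce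
    then show "T P N = 0" unfolding T_def by (simp only: sum.empty)
  qed
  then show ?thesis unfolding KL_assignment_def by (simp add: Z)
qed

text \<open>Dually, the flat \<open>ground N\<close> contributes \<open>Q N\<close> with coefficient
  1, and restriction to any other flat has smaller rank.\<close>

lemma ex1_inv_KL_assignment: "\<exists>!Q. inv_KL_assignment (Q :: 'a matroid \<Rightarrow> int poly)"
proof -
  define T where "T Q N = (\<Sum>F\<in>flats N - {ground N}.
      monom ((-1) ^ (rank N - rk N F) * moebius_invariant (contraction N F)) (rank N - rk N F)
      * Q (restriction N F))" for Q :: "'a matroid \<Rightarrow> int poly" and N
  have Y: "inv_Z_sum Q N = Q N + T Q N" if "N \<in> loopless_matroids" for Q N
  proof -
    interpret finite_matroid N using loopless_matroidsD(1)[OF that] .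
    have "moebius_invariant (contraction N (ground N)) = 1"
      by (simp add: moebius_invariant_def moebius_refl)
    then show ?thesis
      unfolding inv_Z_sum_def T_def
      by (subst sum.remove[OF finite_flats ground_in_flats])
        (simp add: restriction_ground monom_0 one_pCons[symmetric])
  qed
  have smaller: "restriction N F \<in> loopless_matroids" "rank (restriction N F) = rk N F"
      "rk N F < rank N"
    if N: "N \<in> loopless_matroids" and F: "F \<in> flats N - {ground N}" for N and F :: "'a set"
  proof -
    interpret finite_matroid N using loopless_matroidsD(1)[OF N] .
    have F': "F \<subseteq> ground N" "F \<in> flats N" using F flats_subset_ground by auto
    show "restriction N F \<in> loopless_matroids" by (rule restriction_in_loopless_matroids[OF N F'(1)])
    show "rank (restriction N F) = rk N F" by (simp add: rk_restriction)
    show "rk N F < rank N"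
      using rk_flats_strict_mono[OF F'(2)] F F' by auto
  qed
  have "\<exists>!Q. Q \<in> extensional loopless_matroids \<and> (\<forall>N\<in>loopless_matroids.
      (rank N = 0 \<longrightarrow> Q N = 1) \<and> (rank N > 0 \<longrightarrow> 2 * degree (Q N) < rank N) \<and>
      palindromic (rank N) (Q N + T Q N))"
  proof (rule ex1_palindromic_assignment)
    fix N :: "'a matroid" and Q Q' :: "'a matroid \<Rightarrow> int poly" assume N: "N \<in> loopless_matroids"
    { assume Q: "\<And>N'. N' \<in> loopless_matroids \<Longrightarrow> rank N' < rank N \<Longrightarrow> Q N' = Q' N'"
      have "Q (restriction N F) = Q' (restriction N F)" if "F \<in> flats N - {ground N}" for F
        using Q[OF smaller(1)[OF N that]] smaller(2,3)[OF N that] by linarith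
      then show "T Q N = T Q' N" unfolding T_def by (intro sum.cong) simp_all }
    { assume Q: "\<And>N'. N' \<in> loopless_matroids \<Longrightarrow> rank N' < rank N \<Longrightarrow> degree (Q N') \<le> rank N'"
      have "degree (monom c (rank N - rk N F) * Q (restriction N F)) \<le> rank N"
        if "F \<in> flats N - {ground N}" for F c
        using Q[OF smaller(1)[OF N that]] smaller(2,3)[OF N that]
          degree_mult_le[of "monom c (rank N - rk N F)" "Q (restriction N F)"]
          degree_monom_le[of c "rank N - rk N F"]
        by simp
      then show "degree (T Q N) \<le> rank N" unfolding T_def
        by (intro degree_sum_le)
          (use finite_matroid.finite_flats[OF loopless_matroidsD(1)[OF N]] in auto) }
    assume "rank N = 0"
    then have "flats N - {ground N} = {}" using smaller(3)[OF N] by fastforce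
    then show "T Q N = 0" unfolding T_def by (simp only: sum.empty)
  qed
  then show ?thesis unfolding inv_KL_assignment_def by (simp add: Y)
qed

lemma remove_loops_loopless: "N \<in> loopless_matroids \<Longrightarrow> remove_loops N = N"
  by (simp add: remove_loops_def loopless_matroids_def)

text \<open>The characterization passes from the definite description to \<open>KL_poly\<close>
  because contracting a flat stays within the loopless matroids, where \<open>remove_loops\<close>
  changes nothing.\<close>

lemma
  assumes N: "N \<in> loopless_matroids"
  shows KL_poly_rank_0: "rank N = 0 \<Longrightarrow> KL_poly N = 1"
    and degree_KL_poly: "rank N > 0 \<Longrightarrow> 2 * degree (KL_poly N) < rank N"
    and palindromic_Z_sum: "palindromic (rank N) (Z_sum KL_poly N)"
proof -
  define P where "P = (THE P. KL_assignment (P :: 'a matroid \<Rightarrow> int poly))"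
  have P: "KL_assignment P" unfolding P_def by (rule theI'[OF ex1_KL_assignment])
  have eq: "KL_poly N = P N" if "N \<in> loopless_matroids" for N
    using that by (simp add: KL_poly_def P_def remove_loops_loopless)
  then have "Z_sum KL_poly N = Z_sum P N"
    unfolding Z_sum_def using N by (intro sum.cong) (simp_all add: contraction_in_loopless_matroids)
  then show "rank N = 0 \<Longrightarrow> KL_poly N = 1" "rank N > 0 \<Longrightarrow> 2 * degree (KL_poly N) < rank N"
    "palindromic (rank N) (Z_sum KL_poly N)"
    using P N eq[OF N] by (auto simp: KL_assignment_def)
qed

lemma
  assumes N: "N \<in> loopless_matroids"
  shows inv_KL_poly_rank_0: "rank N = 0 \<Longrightarrow> inv_KL_poly N = 1"
    and degree_inv_KL_poly: "rank N > 0 \<Longrightarrow> 2 * degree (inv_KL_poly N) < rank N"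
    and palindromic_inv_Z_sum: "palindromic (rank N) (inv_Z_sum inv_KL_poly N)"
proof -
  define Q where "Q = (THE Q. inv_KL_assignment (Q :: 'a matroid \<Rightarrow> int poly))"
  have Q: "inv_KL_assignment Q" unfolding Q_def by (rule theI'[OF ex1_inv_KL_assignment])
  have eq: "inv_KL_poly N = Q N" if "N \<in> loopless_matroids" for N
    using that by (simp add: inv_KL_poly_def Q_def remove_loops_loopless)
  then have "inv_Z_sum inv_KL_poly N = inv_Z_sum Q N"
    unfolding inv_Z_sum_def using N
    by (intro sum.cong) (simp_all add: restriction_in_loopless_matroids flats_subset_ground)
  then show "rank N = 0 \<Longrightarrow> inv_KL_poly N = 1" "rank N > 0 \<Longrightarrow> 2 * degree (inv_KL_poly N) < rank N"
    "palindromic (rank N) (inv_Z_sum inv_KL_poly N)"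
    using Q N eq[OF N] by (auto simp: inv_KL_assignment_def)
qed

lemma inv_Z_poly_loopless: "N \<in> loopless_matroids \<Longrightarrow> inv_Z_poly N = inv_Z_sum inv_KL_poly N"
  by (simp add: inv_Z_poly_def remove_loops_loopless)

text \<open>Weak form of the degree bound that also covers rank 0, where the polynomial is
  1.\<close>

lemma double_degree_KL_poly_le: "N \<in> loopless_matroids \<Longrightarrow> 2 * degree (KL_poly N) \<le> rank N"
  using KL_poly_rank_0[of N] degree_KL_poly[of N] by (cases "rank N = 0") auto

lemma double_degree_inv_KL_poly_le: "N \<in> loopless_matroids \<Longrightarrow> 2 * degree (inv_KL_poly N) \<le> rank N"
  using inv_KL_poly_rank_0[of N] degree_inv_KL_poly[of N] by (cases "rank N = 0") auto


section \<open>The leading coefficient of the inverse Kazhdan--Lusztig polynomial\<close>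

lemma moebius_invariant_minor:
  assumes "finite_matroid M" "B \<in> flats M" "A \<subseteq> B"
  shows "moebius_invariant (minor M A B) = moebius (flats M) A B"
proof -
  interpret finite_matroid M by fact
  have "finite B" using flats_subset_ground[OF assms(2)] finite_ground by (rule finite_subset)
  then show ?thesis
    using assms by (simp add: moebius_invariant_def flats_minor moebius_interval_shift)
qed

context
  fixes M :: "'a matroid"
  assumes M: "M \<in> loopless_matroids"
begin

interpretation finite_matroid M
  using loopless_matroidsD(1)[OF M] .

text \<open>Flats of the interval minor are the \<open>F - A\<close> with \<open>F\<close> in the
  interval, and contracting \<open>F - A\<close> leaves the interval from \<open>F\<close> to
  \<open>B\<close>. The defining sums thereby become products in the incidence algebra of
  \<open>flats M\<close>.\<close>

lemma Z_sum_minor: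
  assumes A: "A \<in> flats M" and B: "B \<in> flats M" and AB: "A \<subseteq> B"
  shows "Z_sum P (minor M A B) =
    (\<Sum>F | F \<in> flats M \<and> A \<subseteq> F \<and> F \<subseteq> B. monom 1 (rk M F - rk M A) * P (minor M F B))"
proof -
  have sub: "B \<subseteq> ground M" using B by (rule flats_subset_ground)
  interpret N: finite_matroid "minor M A B" using AB sub by (rule finite_matroid_minor)
  show ?thesis
    unfolding Z_sum_def flats_minor[OF B AB]
  proof (rule sum.reindex_cong[of "\<lambda>F. F - A"])
    show "inj_on (\<lambda>F. F - A) {F. F \<in> flats M \<and> A \<subseteq> F \<and> F \<subseteq> B}" by (intro inj_onI) blast
    fix F assume "F \<in> {F. F \<in> flats M \<and> A \<subseteq> F \<and> F \<subseteq> B}"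
    then have F: "A \<subseteq> F" "F \<subseteq> B" by auto
    have "contraction (minor M A B) (F - A) = minor (minor M A B) (F - A) (B - A)"
      using N.minor_ground by simp
    also have "\<dots> = minor M F B" using F sub by (intro minor_minor) auto
    finally show "monom 1 (rk (minor M A B) (F - A)) * P (contraction (minor M A B) (F - A)) =
        monom 1 (rk M F - rk M A) * P (minor M F B)"
      using F by (simp add: rk_minor[OF AB sub] Diff_mono Un_absorb2)
  qed simp
qed

lemma inv_Z_sum_minor:
  assumes A: "A \<in> flats M" and B: "B \<in> flats M" and AB: "A \<subseteq> B"
  shows "inv_Z_sum Q (minor M A B) =
    (\<Sum>F | F \<in> flats M \<and> A \<subseteq> F \<and> F \<subseteq> B.
      monom ((-1) ^ (rk M B - rk M F) * moebius (flats M) F B) (rk M B - rk M F) * Q (minor M A F))"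
proof -
  have sub: "B \<subseteq> ground M" using B by (rule flats_subset_ground)
  interpret N: finite_matroid "minor M A B" using AB sub by (rule finite_matroid_minor)
  show ?thesis
    unfolding inv_Z_sum_def flats_minor[OF B AB]
  proof (rule sum.reindex_cong[of "\<lambda>F. F - A"])
    show "inj_on (\<lambda>F. F - A) {F. F \<in> flats M \<and> A \<subseteq> F \<and> F \<subseteq> B}" by (intro inj_onI) blast
    fix F assume "F \<in> {F. F \<in> flats M \<and> A \<subseteq> F \<and> F \<subseteq> B}"
    then have F: "A \<subseteq> F" "F \<subseteq> B" by auto
    have "contraction (minor M A B) (F - A) = minor (minor M A B) (F - A) (B - A)"
      using N.minor_ground by simp
    also have "\<dots> = minor M F B" using F sub by (intro minor_minor) auto
    finally have "contraction (minor M A B) (F - A) = minor M F B" .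
    moreover have "restriction (minor M A B) (F - A) = minor (minor M A B) (A - A) (F - A)"
      using F N.minor_empty[of "F - A"] by (simp add: Diff_mono)
    then have "restriction (minor M A B) (F - A) = minor M A F"
      using F sub by (simp only: minor_minor[OF order_refl])
    moreover have "rank (minor M A B) - rk (minor M A B) (F - A) = rk M B - rk M F"
      using F rk_mono[OF F(1)] rk_mono[OF F(2)]
      by (simp add: rk_minor[OF AB sub] Diff_mono AB Un_absorb2)
    ultimately show "monom ((-1) ^ (rank (minor M A B) - rk (minor M A B) (F - A)) *
          moebius_invariant (contraction (minor M A B) (F - A)))
          (rank (minor M A B) - rk (minor M A B) (F - A)) * Q (restriction (minor M A B) (F - A)) =
        monom ((-1) ^ (rk M B - rk M F) * moebius (flats M) F B) (rk M B - rk M F) * Q (minor M A F)"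
      using F by (simp only: moebius_invariant_minor[OF finite_matroid_axioms B])
  qed simp
qed

section \<open>The defining conditions as identities in the incidence algebra of flats\<close>

private definition "\<rho> A B = rk M B - rk M A"
private definition "p A B = (if A \<subseteq> B then KL_poly (minor M A B) else 0)"
text \<open>The sign absorbs the signs of \<open>inv_Z_sum\<close>: those of the two parts of an
  interval multiply to the sign of the whole, leaving a plain convolution with
  \<open>\<mu>x\<close>.\<close>

private definition "q A B = (if A \<subseteq> B then (-1) ^ \<rho> A B * inv_KL_poly (minor M A B) else 0)"
text \<open>Reversal at the rank of the interval; as ranks add along chains, it is compatible with
  convolution.\<close>

private definition "reversed f A B = revp (\<rho> A B) (f A B)"
private definition "zx A B = (if A \<subseteq> B then monom (1::int) (\<rho> A B) else 0)"
private definition "\<mu> A B = monom (moebius (flats M) A B) 0"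
private definition "\<mu>x A B = monom (moebius (flats M) A B) (\<rho> A B)"

private lemma \<rho>_add: "A \<subseteq> F \<Longrightarrow> F \<subseteq> B \<Longrightarrow> \<rho> A B = \<rho> A F + \<rho> F B"
  using rk_mono[of A F] rk_mono[of F B] by (simp add: \<rho>_def)

private lemma finite_flat: "F \<in> flats M \<Longrightarrow> finite F"
  using finite_ground flats_subset_ground by (blast intro: finite_subset)

private lemma rank_minor_flats: "A \<subseteq> B \<Longrightarrow> B \<in> flats M \<Longrightarrow> rank (minor M A B) = \<rho> A B"
  unfolding \<rho>_def by (rule rank_minor) (auto dest: flats_subset_ground)

private lemma minor_flats:
  "A \<in> flats M \<Longrightarrow> B \<in> flats M \<Longrightarrow> A \<subseteq> B \<Longrightarrow> minor M A B \<in> loopless_matroids"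
  by (rule minor_in_loopless_matroids[OF M]) (auto dest: flats_subset_ground)

private lemma degree_sign_mult: "degree ((-1) ^ n * (f :: int poly)) = degree f"
  by (cases "even n") auto

private lemma double_degree_p: "A \<in> flats M \<Longrightarrow> B \<in> flats M \<Longrightarrow> 2 * degree (p A B) \<le> \<rho> A B"
  using double_degree_KL_poly_le[OF minor_flats, of A B] rank_minor_flats[of A B] by (simp add: p_def)

private lemma double_degree_q: "A \<in> flats M \<Longrightarrow> B \<in> flats M \<Longrightarrow> 2 * degree (q A B) \<le> \<rho> A B"
  using double_degree_inv_KL_poly_le[OF minor_flats, of A B] rank_minor_flats[of A B]
  by (simp add: q_def degree_sign_mult)

private lemma conv_\<mu>_zeta: "B \<in> flats M \<Longrightarrow> conv (flats M) \<mu> zeta A B = delta A B"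
proof -
  assume B: "B \<in> flats M"
  have "conv (flats M) \<mu> zeta A B = monom (conv (flats M) (moebius (flats M)) zeta A B) 0"
    unfolding conv_def monom_sum by (intro sum.cong) (auto simp: \<mu>_def zeta_def)
  then show ?thesis
    using moebius_conv_zeta[OF finite_flats B finite_flat[OF B], of A] by (simp add: delta_def)
qed

private lemma conv_zeta_\<mu>: "A \<in> flats M \<Longrightarrow> B \<in> flats M \<Longrightarrow> conv (flats M) zeta \<mu> A B = delta A B"
proof -
  assume A: "A \<in> flats M" and B: "B \<in> flats M"
  have "conv (flats M) zeta \<mu> A B = monom (conv (flats M) zeta (moebius (flats M)) A B) 0"
    unfolding conv_def monom_sum by (intro sum.cong) (auto simp: \<mu>_def zeta_def)
  then show ?thesis
    using zeta_conv_moebius[OF finite_flats flats_subset_ground finite_ground A B] by (simp add: delta_def)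
qed

text \<open>The weights multiply to \<open>x^(\<rho> A B)\<close> in every summand, so this is
  Moebius inversion times that weight, which is 1 on the diagonal.\<close>

private lemma conv_\<mu>x_zx: "B \<in> flats M \<Longrightarrow> conv (flats M) \<mu>x zx A B = delta A B"
proof -
  assume B: "B \<in> flats M"
  have "\<mu>x A C * zx C B = monom (moebius (flats M) A C * zeta C B) (\<rho> A B)" for C
    by (cases "A \<subseteq> C")
      (auto simp: \<mu>x_def zx_def zeta_def mult_monom moebius_not_subset \<rho>_add[of A C B])
  then have "conv (flats M) \<mu>x zx A B = monom (conv (flats M) (moebius (flats M)) zeta A B) (\<rho> A B)"
    by (simp add: conv_def monom_sum)
  then show ?thesis
    using moebius_conv_zeta[OF finite_flats B finite_flat[OF B], of A]
    by (simp add: delta_def \<rho>_def)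
qed

text \<open>This is the palindromicity of \<open>Z_sum\<close> on the interval: the left side is
  that sum, and reversing it removes the powers of \<open>x\<close> and reverses each
  \<open>p F B\<close>.\<close>

private lemma conv_zx_p:
  assumes A: "A \<in> flats M" and B: "B \<in> flats M"
  shows "conv (flats M) zx p A B = conv (flats M) zeta (reversed p) A B"
proof (cases "A \<subseteq> B")
  case True
  let ?I = "{F. F \<in> flats M \<and> A \<subseteq> F \<and> F \<subseteq> B}"
  have "conv (flats M) zx p A B = (\<Sum>F\<in>?I. zx A F * p F B)"
    by (rule conv_restrict) (auto simp: finite_flats zx_def p_def)
  also have "\<dots> = Z_sum KL_poly (minor M A B)"
    unfolding Z_sum_minor[OF A B True] by (intro sum.cong) (auto simp: zx_def p_def \<rho>_def)
  also have "\<dots> = revp (\<rho> A B) (Z_sum KL_poly (minor M A B))"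
    using palindromic_Z_sum[OF minor_flats[OF A B True], unfolded rank_minor_flats[OF True B]]
    by (simp only: palindromic_iff_revp)
  also have "\<dots> = revp (\<rho> A B) (\<Sum>F\<in>?I. monom 1 (\<rho> A F) * p F B)"
    unfolding Z_sum_minor[OF A B True]
    by (intro arg_cong[where f = "revp _"] sum.cong) (auto simp: p_def \<rho>_def)
  also have "\<dots> = (\<Sum>F\<in>?I. revp (\<rho> A B) (monom 1 (\<rho> A F) * p F B))"
  proof (rule revp_sum)
    fix F assume F: "F \<in> ?I"
    then show "degree (monom 1 (\<rho> A F) * p F B) \<le> \<rho> A B"
      using degree_mult_le[of "monom 1 (\<rho> A F)" "p F B"] double_degree_p[of F B] B \<rho>_add[of A F B]
      by (simp add: degree_monom_eq)
  qed (simp add: finite_flats)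
  also have "\<dots> = (\<Sum>F\<in>?I. reversed p F B)"
  proof (rule sum.cong[OF refl])
    fix F assume F: "F \<in> ?I"
    then have "revp (\<rho> A B) (monom 1 (\<rho> A F) * p F B) = revp (\<rho> A F) (monom 1 (\<rho> A F)) * reversed p F B"
      unfolding reversed_def using double_degree_p[of F B] B
      by (simp add: \<rho>_add[of A F B] revp_mult degree_monom_eq)
    then show "revp (\<rho> A B) (monom 1 (\<rho> A F) * p F B) = reversed p F B"
      by (simp add: revp_monom)
  qed
  also have "\<dots> = conv (flats M) zeta (reversed p) A B"
    by (subst conv_restrict) (auto simp: finite_flats zeta_def reversed_def revp_def p_def intro!: sum.cong)
  finally show ?thesis .
next
  case False
  then show ?thesis
    unfolding conv_def by (intro sum.cong) (auto simp: zx_def zeta_def reversed_def revp_def p_def)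
qed

text \<open>Likewise the palindromicity of \<open>inv_Z_sum\<close>, up to a global sign: reversal
  turns \<open>\<mu>x\<close> into \<open>\<mu>\<close> and reverses each
  \<open>q A F\<close>.\<close>

private lemma conv_q_\<mu>x:
  assumes A: "A \<in> flats M" and B: "B \<in> flats M"
  shows "conv (flats M) q \<mu>x A B = conv (flats M) (reversed q) \<mu> A B"
proof (cases "A \<subseteq> B")
  case True
  let ?I = "{F. F \<in> flats M \<and> A \<subseteq> F \<and> F \<subseteq> B}"
  let ?Y = "(-1) ^ \<rho> A B * inv_Z_sum inv_KL_poly (minor M A B)"
  have Y: "?Y = (\<Sum>F\<in>?I. q A F * \<mu>x F B)"
    unfolding inv_Z_sum_minor[OF A B True] sum_distrib_left
  proof (rule sum.cong[OF refl])
    fix F assume "F \<in> ?I"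
    then have F: "A \<subseteq> F" "F \<subseteq> B" by auto
    have "monom ((-1) ^ \<rho> F B * moebius (flats M) F B) (\<rho> F B) = (-1) ^ \<rho> F B * \<mu>x F B"
      by (cases "even (\<rho> F B)") (simp_all add: \<mu>x_def minus_monom)
    moreover have "(-1) ^ \<rho> A B * (-1) ^ \<rho> F B = ((-1) ^ \<rho> A F :: int poly)"
      unfolding \<rho>_add[OF F] power_add mult.assoc by (simp flip: power_mult_distrib)
    ultimately show "(-1) ^ \<rho> A B *
        (monom ((-1) ^ (rk M B - rk M F) * moebius (flats M) F B) (rk M B - rk M F) *
          inv_KL_poly (minor M A F)) = q A F * \<mu>x F B"
      using F by (simp add: q_def \<rho>_def[of F B, symmetric] mult_ac)
  qed
  have "palindromic (\<rho> A B) ?Y"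
    using palindromic_inv_Z_sum[OF minor_flats[OF A B True], unfolded rank_minor_flats[OF True B]]
    by (cases "even (\<rho> A B)") (simp_all add: palindromic_iff_coeff)
  then have "revp (\<rho> A B) ?Y = ?Y" by (simp add: palindromic_iff_revp)
  then have "(\<Sum>F\<in>?I. q A F * \<mu>x F B) = revp (\<rho> A B) (\<Sum>F\<in>?I. q A F * \<mu>x F B)"
    unfolding Y by simp
  also have "\<dots> = (\<Sum>F\<in>?I. revp (\<rho> A B) (q A F * \<mu>x F B))"
  proof (rule revp_sum)
    fix F assume F: "F \<in> ?I"
    then show "degree (q A F * \<mu>x F B) \<le> \<rho> A B"
      using degree_mult_le[of "q A F" "\<mu>x F B"] double_degree_q[of A F] A \<rho>_add[of A F B]
        degree_monom_le[of "moebius (flats M) F B" "\<rho> F B"]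
      by (simp add: \<mu>x_def)
  qed (simp add: finite_flats)
  also have "\<dots> = (\<Sum>F\<in>?I. reversed q A F * \<mu> F B)"
  proof (rule sum.cong[OF refl])
    fix F assume F: "F \<in> ?I"
    then have "revp (\<rho> A B) (q A F * \<mu>x F B) = reversed q A F * revp (\<rho> F B) (\<mu>x F B)"
      unfolding reversed_def using double_degree_q[of A F] A
      by (simp add: \<rho>_add[of A F B] revp_mult \<mu>x_def degree_monom_le)
    then show "revp (\<rho> A B) (q A F * \<mu>x F B) = reversed q A F * \<mu> F B"
      by (simp add: revp_monom \<mu>x_def \<mu>_def)
  qed
  also have "\<dots> = conv (flats M) (reversed q) \<mu> A B"
    by (subst conv_restrict) (auto simp: finite_flats \<mu>_def reversed_def revp_def q_def moebius_not_subset)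
  also have "(\<Sum>F\<in>?I. q A F * \<mu>x F B) = conv (flats M) q \<mu>x A B"
    by (subst conv_restrict) (auto simp: finite_flats \<mu>x_def q_def moebius_not_subset)
  finally show ?thesis .
next
  case False
  then have "q A F * \<mu>x F B = 0" "reversed q A F * \<mu> F B = 0" for F
    by (cases "A \<subseteq> F"; auto simp: q_def reversed_def revp_def \<mu>x_def \<mu>_def moebius_not_subset)+
  then show ?thesis unfolding conv_def by (simp only:)
qed

text \<open>Solving the two preceding identities gives reversed \<open>p\<close> as
  \<open>\<mu>\<close> times \<open>zx\<close> times \<open>p\<close>, and reversed \<open>q\<close>
  as \<open>q\<close> times \<open>\<mu>x\<close> times \<open>zeta\<close>. In the product, first
  \<open>zeta\<close> with \<open>\<mu>\<close> and then \<open>\<mu>x\<close> with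
  \<open>zx\<close> cancel.\<close>

private lemma conv_rev:
  assumes A: "A \<in> flats M" and B: "B \<in> flats M"
  shows "conv (flats M) (reversed q) (reversed p) A B = conv (flats M) q p A B"
proof -
  let ?L = "flats M"
  have rev_p: "reversed p F B = conv ?L \<mu> (conv ?L zx p) F B" if F: "F \<in> ?L" for F
  proof -
    have "conv ?L \<mu> (conv ?L zx p) F B = conv ?L \<mu> (conv ?L zeta (reversed p)) F B"
      by (rule conv_cong) (simp_all add: conv_zx_p B)
    also have "\<dots> = conv ?L delta (reversed p) F B"
      unfolding conv_assoc[symmetric] by (rule conv_cong) (simp_all add: conv_\<mu>_zeta)
    finally show ?thesis using F by (simp add: conv_delta_left finite_flats)
  qed
  have rev_q: "reversed q A F = conv ?L (conv ?L q \<mu>x) zeta A F" if F: "F \<in> ?L" for F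
  proof -
    have "conv ?L (conv ?L q \<mu>x) zeta A F = conv ?L (conv ?L (reversed q) \<mu>) zeta A F"
      by (rule conv_cong) (simp_all add: conv_q_\<mu>x A)
    also have "\<dots> = conv ?L (reversed q) delta A F"
      unfolding conv_assoc by (rule conv_cong) (simp_all add: conv_\<mu>_zeta F)
    finally show ?thesis using F by (simp add: conv_delta_right finite_flats)
  qed
  have "conv ?L (reversed q) (reversed p) A B =
      conv ?L (conv ?L (conv ?L q \<mu>x) zeta) (conv ?L \<mu> (conv ?L zx p)) A B"
    by (rule conv_cong) (simp_all add: rev_p rev_q)
  also have "\<dots> = conv ?L (conv ?L q \<mu>x) (conv ?L (conv ?L zeta \<mu>) (conv ?L zx p)) A B"
    by (simp only: conv_assoc)
  also have "\<dots> = conv ?L (conv ?L q \<mu>x) (conv ?L zx p) A B"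
  proof (rule conv_cong)
    fix F assume F: "F \<in> ?L"
    have "conv ?L (conv ?L zeta \<mu>) (conv ?L zx p) F B = conv ?L delta (conv ?L zx p) F B"
      by (rule conv_cong) (simp_all add: conv_zeta_\<mu> F)
    then show "conv ?L (conv ?L zeta \<mu>) (conv ?L zx p) F B = conv ?L zx p F B"
      using F by (simp add: conv_delta_left finite_flats)
  qed simp
  also have "\<dots> = conv ?L q (conv ?L (conv ?L \<mu>x zx) p) A B"
    by (simp only: conv_assoc)
  also have "\<dots> = conv ?L q p A B"
  proof (rule conv_cong)
    fix F assume F: "F \<in> ?L"
    have "conv ?L (conv ?L \<mu>x zx) p F B = conv ?L delta p F B"
      by (rule conv_cong) (simp_all add: conv_\<mu>x_zx F)
    then show "conv ?L (conv ?L \<mu>x zx) p F B = p F B"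
      using F by (simp add: conv_delta_left finite_flats)
  qed simp
  finally show ?thesis .
qed

text \<open>Since reversal fixes the convolution of \<open>q\<close> and \<open>p\<close>, this sum is palindromic of degree
  \<open>rank M\<close>, but every summand has degree less than half of that.\<close>

lemma sum_inv_KL_poly_KL_poly:
  assumes "rank M > 0"
  shows "(\<Sum>F\<in>flats M. (-1) ^ rk M F * inv_KL_poly (restriction M F) * KL_poly (contraction M F)) = 0"
proof -
  let ?E = "ground M"
  have E: "?E \<in> flats M" by (rule ground_in_flats)
  have empty: "{} \<in> flats M" using empty_in_flats loopless_matroidsD(2)[OF M] .
  have rank: "\<rho> {} ?E = rank M" by (simp add: \<rho>_def)
  have sub: "F \<subseteq> ?E" if "F \<in> flats M" for F using that by (rule flats_subset_ground)
  let ?W = "\<Sum>F\<in>flats M. q {} F * p F ?E"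
  \<comment> \<open>A factor on an interval of rank 0 satisfies only the weak bound, but as
    \<open>rank M > 0\<close> at least one of the two intervals has positive rank and gives
    strictness.\<close>
  have deg: "2 * degree (q {} F * p F ?E) < rank M" if F: "F \<in> flats M" for F
  proof -
    have "\<rho> {} ?E = \<rho> {} F + \<rho> F ?E" using sub[OF F] by (intro \<rho>_add) auto
    moreover have "2 * degree (q {} F) < \<rho> {} F" if "\<rho> {} F > 0"
      using degree_inv_KL_poly[OF minor_flats[OF empty F]] that rank_minor_flats[of "{}" F] F
      by (simp add: q_def degree_sign_mult)
    moreover have "2 * degree (p F ?E) < \<rho> F ?E" if "\<rho> F ?E > 0"
      using degree_KL_poly[OF minor_flats[OF F E]] that rank_minor_flats[of F ?E] E sub[OF F]
      by (simp add: p_def)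
    ultimately show ?thesis
      using assms rank double_degree_q[OF empty F] double_degree_p[OF F E]
        degree_mult_le[of "q {} F" "p F ?E"]
      by linarith
  qed
  have "revp (rank M) ?W = (\<Sum>F\<in>flats M. revp (rank M) (q {} F * p F ?E))"
    by (rule revp_sum) (use deg finite_flats in fastforce)+
  also have "\<dots> = (\<Sum>F\<in>flats M. reversed q {} F * reversed p F ?E)"
  proof (rule sum.cong[OF refl])
    fix F assume F: "F \<in> flats M"
    have "rank M = \<rho> {} F + \<rho> F ?E" unfolding rank[symmetric] using sub[OF F] by (intro \<rho>_add) auto
    then show "revp (rank M) (q {} F * p F ?E) = reversed q {} F * reversed p F ?E"
      using double_degree_q[OF empty F] double_degree_p[OF F E] by (simp add: reversed_def revp_mult)
  qed
  also have "\<dots> = ?W"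
    using conv_rev[OF empty E] by (simp add: conv_def)
  finally have "revp (rank M) ?W = ?W" .
  moreover have deg_W: "2 * degree ?W < rank M"
  proof -
    have "degree ?W \<le> (rank M - 1) div 2"
      by (rule degree_sum_le[OF finite_flats]) (use deg in fastforce)
    then show ?thesis using assms by linarith
  qed
  ultimately have "?W = 0"
    by (intro palindromic_low_degree_eq_0) (auto simp: palindromic_iff_revp)
  moreover have "?W = (\<Sum>F\<in>flats M. (-1) ^ rk M F * inv_KL_poly (restriction M F) * KL_poly (contraction M F))"
    by (intro sum.cong) (auto simp: p_def q_def \<rho>_def minor_empty minor_ground dest: sub)
  ultimately show ?thesis by simp
qed

end

text \<open>Take the coefficient of degree \<open>(r - 1)/2\<close> in the vanishing sum. At a flat
  strictly between the extremes both strict degree bounds apply and the product has smaller degree.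
  The empty flat leaves \<open>KL_poly M\<close>, and the ground set leaves
  \<open>- inv_KL_poly M\<close> because the rank is odd.\<close>

lemma coeff_inv_KL_poly_eq_tau:
  assumes M: "M \<in> loopless_matroids" and odd: "odd (rank M)"
  shows "coeff (inv_KL_poly M) ((rank M - 1) div 2) = tau M"
proof -
  interpret finite_matroid M using loopless_matroidsD(1)[OF M] .
  define k where "k = (rank M - 1) div 2"
  have k: "rank M = 2 * k + 1" using odd by (auto simp: k_def elim!: oddE)
  have empty: "{} \<in> flats M" using empty_in_flats loopless_matroidsD(2)[OF M] .
  let ?f = "\<lambda>F. (-1) ^ rk M F * inv_KL_poly (restriction M F) * KL_poly (contraction M F)"
  have "coeff (?f F) k = 0" if F: "F \<in> flats M - {{}, ground M}" for F
  proof -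
    have sub: "F \<subseteq> ground M" using F flats_subset_ground by auto
    have "0 < rk M F" using rk_flats_strict_mono[OF empty _ sub] F by fastforce
    moreover have "rk M F < rank M" using rk_flats_strict_mono[of F "ground M"] F sub by auto
    moreover have "rank (restriction M F) = rk M F" by (simp add: rk_restriction)
    moreover have "rank (contraction M F) = rank M - rk M F"
      using sub by (simp add: rk_contraction Un_absorb2)
    ultimately have "2 * degree (inv_KL_poly (restriction M F)) < rk M F"
      "2 * degree (KL_poly (contraction M F)) < rank M - rk M F"
      using F degree_inv_KL_poly[OF restriction_in_loopless_matroids[OF M sub]]
        degree_KL_poly[OF contraction_in_loopless_matroids[OF M, of F]] by auto
    then have "degree (inv_KL_poly (restriction M F) * KL_poly (contraction M F)) < k"
      using k degree_mult_le[of "inv_KL_poly (restriction M F)" "KL_poly (contraction M F)"] by linarith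
    then have "coeff (inv_KL_poly (restriction M F) * KL_poly (contraction M F)) k = 0"
      by (rule coeff_eq_0)
    then show ?thesis by (cases "even (rk M F)") (simp_all add: mult.assoc)
  qed
  then have "(\<Sum>F\<in>flats M. coeff (?f F) k) = (\<Sum>F\<in>{{}, ground M}. coeff (?f F) k)"
    using empty ground_in_flats[of M] by (intro sum.mono_neutral_right finite_flats) auto
  moreover have "(\<Sum>F\<in>flats M. coeff (?f F) k) = 0"
    using sum_inv_KL_poly_KL_poly[OF M] k by (simp flip: coeff_sum)
  moreover have "{} \<noteq> ground M" using k by auto
  moreover have "?f {} = KL_poly M"
    using inv_KL_poly_rank_0[OF restriction_in_loopless_matroids[OF M, of "{}"]]
    by (simp add: contraction_empty rk_restriction)
  moreover have "?f (ground M) = - inv_KL_poly M"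
    using KL_poly_rank_0[OF contraction_in_loopless_matroids[OF M ground_in_flats]] odd
      finite_matroid.rk_empty[OF finite_matroid_contraction[OF order_refl]]
    by (simp add: restriction_ground)
  ultimately show ?thesis using odd by (simp add: tau_def k_def)
qed


section \<open>The deletion formula\<close>

text \<open>The coloop case is included because \<open>i\<close> can become a coloop in a
  restriction to a flat, and the induction runs through all these restrictions.\<close>

definition deletion_rhs :: "'a matroid \<Rightarrow> 'a \<Rightarrow> int poly" where
  "deletion_rhs M i =
     (if coloop M i then monom (-1) 1 else 1) * inv_KL_poly (deletion M {i})
     + [:1, 1:] * inv_KL_poly (contraction M {i})
     - (\<Sum>F\<in>deletion_flats M i.
          monom (tau (minor M {i} F)) (rk M F div 2) * inv_KL_poly (contraction M F))"

context
  fixes M :: "'a matroid" and i :: 'a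
  assumes M: "M \<in> loopless_matroids" and i: "i \<in> ground M" "{i} \<in> flats M"
begin

interpretation finite_matroid M
  using loopless_matroidsD(1)[OF M] .

private lemma rk_i: "rk M {i} = 1"
  using M i(1) by (auto simp: loopless_matroids_def loopless_def indep_iff_rk)

private lemma rank_pos: "rank M > 0"
  using rk_mono[of "{i}" "ground M"] i(1) rk_i by simp

private lemma empty_flat: "{} \<in> flats M"
  using empty_in_flats loopless_matroidsD(2)[OF M] .

private lemma finite_deletion_flats: "finite (deletion_flats M i)"
  by (simp add: deletion_flats_def finite_flats)

private lemma rank_contraction: "F \<in> flats M \<Longrightarrow> rank (contraction M F) = rank M - rk M F"
  by (simp add: rk_contraction flats_subset_ground Un_absorb2)

private lemma rank_minor_i: "F \<in> flats M \<Longrightarrow> i \<in> F \<Longrightarrow> rank (minor M {i} F) = rk M F - 1"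
  using rank_minor[of "{i}" F] by (simp add: flats_subset_ground rk_i)

private lemma deletion_in: "deletion M {i} \<in> loopless_matroids"
  unfolding deletion_def by (rule restriction_in_loopless_matroids[OF M]) blast

private lemma rk_remove_flat: "F \<in> flats M \<Longrightarrow> i \<in> F \<Longrightarrow> F - {i} \<in> flats M \<Longrightarrow> rk M F = Suc (rk M (F - {i}))"
  using rk_insert_flat[of "F - {i}" i] i(1) by (simp add: insert_absorb)

text \<open>The closure of \<open>F - {i}\<close> lies in \<open>F\<close> and is strictly larger
  than \<open>F - {i}\<close>, so it is \<open>F\<close>.\<close>

private lemma rk_remove_nonflat:
  assumes F: "F \<in> flats M" and "F - {i} \<notin> flats M"
  shows "rk M (F - {i}) = rk M F"
proof -
  have sub: "F - {i} \<subseteq> ground M" using flats_subset_ground[OF F] by auto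
  have "closure_of M (F - {i}) \<subseteq> F" by (rule closure_of_subset_flat[OF F]) blast
  moreover have "closure_of M (F - {i}) \<noteq> F - {i}" using closure_of_in_flats[OF sub] assms(2) by metis
  ultimately have "closure_of M (F - {i}) = F" using subset_closure_of[OF sub] by blast
  then show ?thesis using rk_closure_of[OF sub] by simp
qed

text \<open>Otherwise \<open>F - {i}\<close> would span \<open>i\<close>, and so would the larger
  set \<open>ground M - {i}\<close>.\<close>

private lemma coloop_remove_flat:
  assumes coloop: "coloop M i" and F: "F \<in> flats M" "i \<in> F"
  shows "F - {i} \<in> flats M"
proof (rule ccontr)
  assume "F - {i} \<notin> flats M"
  then have "rk M (insert i (F - {i})) = rk M (F - {i})"
    using rk_remove_nonflat[OF F(1)] F(2) by (simp add: insert_absorb)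
  then have "rk M (insert i (ground M - {i})) = rk M (ground M - {i})"
    by (rule rk_insert_eq_mono) (use flats_subset_ground[OF F(1)] in blast)
  then show False using coloop i(1) by (simp add: coloop_iff_rk insert_absorb)
qed

text \<open>Rewrites everything in terms of \<open>M\<close>, so that \<open>F\<close> can vary in a
  sum. The coloop test becomes whether \<open>F - {i}\<close> is a flat.\<close>

private lemma deletion_rhs_restriction:
  assumes F: "F \<in> flats M" and iF: "i \<in> F"
  shows "deletion_rhs (restriction M F) i =
    (if F - {i} \<in> flats M then monom (-1) 1 else 1) * inv_KL_poly (restriction M (F - {i}))
    + [:1, 1:] * inv_KL_poly (minor M {i} F)
    - (\<Sum>G | G \<in> deletion_flats M i \<and> G \<subseteq> F.
         monom (tau (minor M {i} G)) (rk M G div 2) * inv_KL_poly (minor M G F))"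
proof -
  interpret R: finite_matroid "restriction M F"
    using flats_subset_ground[OF F] by (rule finite_matroid_restriction)
  have "coloop (restriction M F) i \<longleftrightarrow> F - {i} \<in> flats M"
    using R.coloop_iff_flat[of i] iF by (simp add: flats_restriction[OF F])
  moreover have "deletion (restriction M F) {i} = restriction M (F - {i})"
    by (simp add: deletion_def restriction_restriction)
  moreover have "deletion_flats (restriction M F) i = {G. G \<in> deletion_flats M i \<and> G \<subseteq> F}"
    by (auto simp: deletion_flats_def flats_restriction[OF F])
  moreover have "(\<Sum>G\<in>{G. G \<in> deletion_flats M i \<and> G \<subseteq> F}.
        monom (tau (minor (restriction M F) {i} G)) (rk (restriction M F) G div 2) *
        inv_KL_poly (contraction (restriction M F) G)) =
      (\<Sum>G | G \<in> deletion_flats M i \<and> G \<subseteq> F.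
         monom (tau (minor M {i} G)) (rk M G div 2) * inv_KL_poly (minor M G F))"
    by (intro sum.cong refl)
      (auto simp: minor_def restriction_restriction rk_restriction inf.absorb1)
  ultimately show ?thesis
    unfolding deletion_rhs_def minor_def[of M "{i}" F] by (simp only:)
qed

text \<open>Both sides have the same sums over up-sets of the lattice of flats of the deletion, since
  \<open>F - {i}\<close> contains \<open>G\<close> exactly if \<open>F\<close> contains the closure of \<open>G\<close>.\<close>

private lemma sum_moebius_fibre:
  assumes G: "G \<in> flats (deletion M {i})"
  shows "(\<Sum>F | F \<in> flats M \<and> F - {i} = G. moebius (flats M) F (ground M)) =
    (if coloop M i then 0 else moebius (flats (deletion M {i})) G (ground M - {i}))"
proof -
  let ?L = "flats M" and ?E = "ground M"
  let ?L' = "flats (deletion M {i})"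
  interpret D: finite_matroid "deletion M {i}" using loopless_matroidsD(1)[OF deletion_in] .
  let ?m = "\<lambda>G. \<Sum>F | F \<in> ?L \<and> F - {i} = G. moebius ?L F ?E"
  have sub: "G \<subseteq> ?E - {i}" if "G \<in> ?L'" for G
    using flats_subset_ground[OF that] by simp
  have sum_m: "(\<Sum>C | C \<in> ?L' \<and> G \<subseteq> C. ?m C) = of_bool (closure_of M G = ?E)" if G: "G \<in> ?L'" for G
  proof -
    have GE: "G \<subseteq> ?E" using sub[OF G] by blast
    let ?S = "{F \<in> ?L. G \<subseteq> F}"
    have S: "{C. C \<in> ?L' \<and> G \<subseteq> C} = (\<lambda>F. F - {i}) ` ?S"
      unfolding flats_deletion using sub[OF G] by blast
    have fibre: "{F. F \<in> ?L \<and> F - {i} = C} = {F \<in> ?S. F - {i} = C}"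
      if "C \<in> (\<lambda>F. F - {i}) ` ?S" for C
      using that sub[OF G] by blast
    have "(\<Sum>C | C \<in> ?L' \<and> G \<subseteq> C. ?m C) = (\<Sum>C\<in>(\<lambda>F. F - {i}) ` ?S. \<Sum>F\<in>{F \<in> ?S. F - {i} = C}. moebius ?L F ?E)"
      unfolding S by (rule sum.cong[OF refl]) (simp only: fibre)
    also have "\<dots> = (\<Sum>F\<in>?S. moebius ?L F ?E)"
      by (rule sum.image_gen[symmetric]) (simp add: finite_flats)
    also have "?S = {F. F \<in> ?L \<and> closure_of M G \<subseteq> F}"
      using closure_of_subset_flat subset_closure_of[OF GE] by blast
    also have "(\<Sum>F | F \<in> ?L \<and> closure_of M G \<subseteq> F. moebius ?L F ?E) =
        conv ?L zeta (moebius ?L) (closure_of M G) ?E"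
      unfolding conv_def by (intro sum.mono_neutral_cong_left) (auto simp: finite_flats zeta_def)
    also have "\<dots> = of_bool (closure_of M G = ?E)"
      using zeta_conv_moebius[OF finite_flats flats_subset_ground finite_ground
          closure_of_in_flats[OF GE] ground_in_flats] by (simp add: delta_def)
    finally show ?thesis .
  qed
  show ?thesis
  proof (cases "coloop M i")
    case True
    then have flat: "?E - {i} \<in> ?L" using coloop_iff_flat[OF i(1)] by simp
    \<comment> \<open>For a coloop the complement of \<open>i\<close> is a flat containing every
      \<open>G\<close>, so no closure is the whole ground set and all up-set sums vanish.\<close>
    have "?m G = 0"
    proof (rule sum_above_inject[OF D.finite_flats _ G, of ?m "\<lambda>_. 0"])
      fix G assume G: "G \<in> ?L'"
      have "closure_of M G \<noteq> ?E" using closure_of_subset_flat[OF flat sub[OF G]] i(1) by auto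
      then show "(\<Sum>C | C \<in> ?L' \<and> G \<subseteq> C. ?m C) = (\<Sum>C | C \<in> ?L' \<and> G \<subseteq> C. 0)"
        by (simp add: sum_m[OF G])
    qed
    with True show ?thesis by simp
  next
    case False
    have "?m G = moebius ?L' G (?E - {i})"
    proof (rule sum_above_inject[OF D.finite_flats _ G, of ?m "\<lambda>C. moebius ?L' C (?E - {i})"])
      fix G assume G: "G \<in> ?L'"
      have E': "?E - {i} \<in> ?L'" using ground_in_flats[of "deletion M {i}"] by simp
      \<comment> \<open>Without a coloop the complement of \<open>i\<close> spans, and no other flat
        of the deletion does. The up-set sums are therefore those of the Moebius function to the
        top.\<close>
      have "closure_of M G = ?E \<longleftrightarrow> G = ?E - {i}"
      proof
        assume cl: "closure_of M G = ?E"
        obtain F where F: "F \<in> ?L" "G = F - {i}" using G unfolding flats_deletion by blast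
        then have "closure_of M G \<subseteq> F" by (intro closure_of_subset_flat) auto
        then show "G = ?E - {i}" using cl F flats_subset_ground[OF F(1)] by auto
      next
        assume G: "G = ?E - {i}"
        have "closure_of M (?E - {i}) \<noteq> ?E - {i}"
          using False closure_of_in_flats[of "?E - {i}"] coloop_iff_flat[OF i(1)] by (metis Diff_subset)
        then show "closure_of M G = ?E"
          unfolding G using subset_closure_of[of "?E - {i}"] closure_of_subset_ground by fastforce
      qed
      then have "(\<Sum>C | C \<in> ?L' \<and> G \<subseteq> C. ?m C) = delta G (?E - {i})"
        by (simp add: sum_m[OF G] delta_def)
      also have "\<dots> = conv ?L' zeta (moebius ?L') G (?E - {i})"
        by (rule zeta_conv_moebius[symmetric, OF D.finite_flats flats_subset_ground D.finite_ground G E'])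
      also have "\<dots> = (\<Sum>C | C \<in> ?L' \<and> G \<subseteq> C. moebius ?L' C (?E - {i}))"
        unfolding conv_def by (intro sum.mono_neutral_cong_right) (auto simp: D.finite_flats zeta_def)
      finally show "(\<Sum>C | C \<in> ?L' \<and> G \<subseteq> C. ?m C) = (\<Sum>C | C \<in> ?L' \<and> G \<subseteq> C. moebius ?L' C (?E - {i}))" .
    qed
    with False show ?thesis by simp
  qed
qed

section \<open>Inverse Z-polynomials as weighted sums over flats\<close>

text \<open>Involves only the interval from \<open>F\<close> to the top, so the same weight serves
  for \<open>M\<close> and for all its contractions by flats.\<close>

private definition "w F = monom ((-1) ^ (rank M - rk M F) * moebius (flats M) F (ground M)) (rank M - rk M F)"

private lemma inv_Z_poly_contraction:
  assumes A: "A \<in> flats M"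
  shows "inv_Z_poly (contraction M A) =
    (\<Sum>F | F \<in> flats M \<and> A \<subseteq> F. w F * inv_KL_poly (minor M A F))"
proof -
  have "{F. F \<in> flats M \<and> A \<subseteq> F \<and> F \<subseteq> ground M} = {F. F \<in> flats M \<and> A \<subseteq> F}"
    by (auto dest: flats_subset_ground)
  then show ?thesis
    using inv_Z_sum_minor[OF M A ground_in_flats flats_subset_ground[OF A], of inv_KL_poly]
    by (simp add: minor_ground w_def inv_Z_poly_loopless[OF contraction_in_loopless_matroids[OF M A]])
qed

private lemma inv_Z_poly_eq: "inv_Z_poly M = (\<Sum>F\<in>flats M. w F * inv_KL_poly (restriction M F))"
  using inv_Z_poly_contraction[OF empty_flat]
  by (simp add: contraction_empty) (auto simp: minor_empty flats_subset_ground intro!: sum.cong)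

private lemma inv_Z_poly_deletion:
  assumes "\<not> coloop M i"
  shows "inv_Z_poly (deletion M {i}) = (\<Sum>G\<in>flats (deletion M {i}).
      monom ((-1) ^ (rank M - rk M G) * moebius (flats (deletion M {i})) G (ground M - {i}))
        (rank M - rk M G) * inv_KL_poly (restriction M G))"
proof -
  let ?N = "deletion M {i}"
  interpret N: finite_matroid ?N using loopless_matroidsD(1)[OF deletion_in] .
  have rank: "rk M (ground M - {i}) = rank M"
    using assms i(1) rk_mono[of "ground M - {i}" "ground M"] by (auto simp: coloop_iff_rk)
  have "inv_Z_poly ?N = inv_Z_sum inv_KL_poly (minor ?N {} (ground ?N))"
    using deletion_in by (simp only: inv_Z_poly_loopless N.minor_ground N.contraction_empty)
  also have "\<dots> = (\<Sum>F | F \<in> flats ?N \<and> {} \<subseteq> F \<and> F \<subseteq> ground ?N.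
      monom ((-1) ^ (rank ?N - rk ?N F) * moebius (flats ?N) F (ground ?N)) (rank ?N - rk ?N F) *
      inv_KL_poly (minor ?N {} F))"
    by (rule inv_Z_sum_minor[OF deletion_in N.empty_in_flats[OF loopless_matroidsD(2)[OF deletion_in]]
          ground_in_flats]) simp
  also have "\<dots> = (\<Sum>G\<in>flats ?N. monom ((-1) ^ (rank M - rk M G) * moebius (flats ?N) G (ground M - {i}))
        (rank M - rk M G) * inv_KL_poly (restriction M G))"
  proof (rule sum.cong)
    show "{F. F \<in> flats ?N \<and> {} \<subseteq> F \<and> F \<subseteq> ground ?N} = flats ?N"
      using flats_subset_ground by blast
    fix G assume "G \<in> flats ?N"
    then have G: "G \<subseteq> ground M - {i}" using flats_subset_ground by fastforce
    then have "minor ?N {} G = restriction M G"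
      using N.minor_empty[of G] by (simp add: deletion_def restriction_restriction)
    moreover have "rk ?N G = rk M G" "rank ?N = rank M"
      using G rank by (simp_all add: deletion_def rk_restriction inf.absorb1)
    ultimately show "monom ((-1) ^ (rank ?N - rk ?N G) * moebius (flats ?N) G (ground ?N))
        (rank ?N - rk ?N G) * inv_KL_poly (minor ?N {} G) =
      monom ((-1) ^ (rank M - rk M G) * moebius (flats ?N) G (ground M - {i}))
        (rank M - rk M G) * inv_KL_poly (restriction M G)"
      by (simp only: ground_deletion)
  qed
  finally show ?thesis .
qed

text \<open>If removing \<open>i\<close> from \<open>F\<close> leaves a flat, the rank drops by one
  and the factor \<open>-x\<close> turns sign and exponent of \<open>w F\<close> into those for
  \<open>F - {i}\<close>; otherwise the rank is unchanged. Grouping by \<open>F - {i}\<close> then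
  leaves the sums of \<open>sum_moebius_fibre\<close>.\<close>

private lemma sum_deletion_part:
  "(\<Sum>F\<in>flats M. w F * ((if i \<in> F \<and> F - {i} \<in> flats M then monom (-1) 1 else 1) *
      inv_KL_poly (restriction M (F - {i})))) =
    (if coloop M i then 0 else inv_Z_poly (deletion M {i}))"
proof -
  let ?L = "flats M" and ?L' = "flats (deletion M {i})" and ?E = "ground M"
  let ?v = "\<lambda>G c. monom ((-1) ^ (rank M - rk M G) * c) (rank M - rk M G)"
  have w: "w F * (if i \<in> F \<and> F - {i} \<in> ?L then monom (-1) 1 else 1) = ?v (F - {i}) (moebius ?L F ?E)"
    if F: "F \<in> ?L" for F
  proof (cases "i \<in> F \<and> F - {i} \<in> ?L")
    case True
    then have "rk M F = Suc (rk M (F - {i}))" using rk_remove_flat F by blast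
    moreover have "rk M F \<le> rank M" using flats_subset_ground[OF F] by (rule rk_mono)
    ultimately have "rank M - rk M (F - {i}) = Suc (rank M - rk M F)" by simp
    with True show ?thesis by (simp add: w_def mult_monom)
  next
    case False
    then have "rk M (F - {i}) = rk M F" using rk_remove_nonflat[OF F] F by (cases "i \<in> F") auto
    with False show ?thesis by (auto simp: w_def)
  qed
  have "(\<Sum>F\<in>?L. w F * ((if i \<in> F \<and> F - {i} \<in> ?L then monom (-1) 1 else 1) *
      inv_KL_poly (restriction M (F - {i})))) =
    (\<Sum>F\<in>?L. ?v (F - {i}) (moebius ?L F ?E) * inv_KL_poly (restriction M (F - {i})))"
    by (rule sum.cong[OF refl]) (simp only: w mult.assoc[symmetric])
  also have "\<dots> = (\<Sum>G\<in>?L'. \<Sum>F\<in>{F \<in> ?L. F - {i} = G}.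
      ?v (F - {i}) (moebius ?L F ?E) * inv_KL_poly (restriction M (F - {i})))"
    unfolding flats_deletion by (rule sum.image_gen[OF finite_flats])
  also have "\<dots> = (\<Sum>G\<in>?L'. ?v G (\<Sum>F | F \<in> ?L \<and> F - {i} = G. moebius ?L F ?E) *
      inv_KL_poly (restriction M G))"
    unfolding sum_distrib_left monom_sum sum_distrib_right by (intro sum.cong refl) auto
  also have "\<dots> = (\<Sum>G\<in>?L'. ?v G (if coloop M i then 0 else moebius ?L' G (?E - {i})) *
      inv_KL_poly (restriction M G))"
    by (rule sum.cong[OF refl]) (simp only: sum_moebius_fibre)
  also have "\<dots> = (if coloop M i then 0 else inv_Z_poly (deletion M {i}))"
    by (simp add: inv_Z_poly_deletion)
  finally show ?thesis .
qed

text \<open>By the hypothesis, exchanging \<open>inv_KL_poly\<close> for \<open>deletion_rhs\<close>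
  throughout the sum for \<open>inv_Z_poly M\<close> changes only the top term, whose weight is 1.
  The new sum is then evaluated part by part.\<close>

private lemma inv_Z_poly_replace:
  assumes IH: "\<And>F. F \<in> flats M \<Longrightarrow> i \<in> F \<Longrightarrow> F \<noteq> ground M \<Longrightarrow>
      inv_KL_poly (restriction M F) = deletion_rhs (restriction M F) i"
  shows "inv_Z_poly M - inv_KL_poly M + deletion_rhs M i =
    (if coloop M i then 0 else inv_Z_poly (deletion M {i})) + [:1, 1:] * inv_Z_poly (contraction M {i})
    - (\<Sum>F\<in>deletion_flats M i.
         monom (tau (minor M {i} F)) (rk M F div 2) * inv_Z_poly (contraction M F))"
proof -
  let ?L = "flats M" and ?E = "ground M" and ?T = "deletion_flats M i"
  let ?t = "\<lambda>G. monom (tau (minor M {i} G)) (rk M G div 2)"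
  define R where "R F = (if i \<in> F then deletion_rhs (restriction M F) i else inv_KL_poly (restriction M F))" for F
  let ?a = "\<lambda>F. (if i \<in> F \<and> F - {i} \<in> ?L then monom (-1) 1 else 1) * inv_KL_poly (restriction M (F - {i}))"
  let ?b = "\<lambda>F. if i \<in> F then [:1, 1:] * inv_KL_poly (minor M {i} F) else 0"
  let ?c = "\<lambda>F. \<Sum>G | G \<in> ?T \<and> G \<subseteq> F. ?t G * inv_KL_poly (minor M G F)"
  have R: "R F = ?a F + ?b F - ?c F" if F: "F \<in> ?L" for F
  \<comment> \<open>For \<open>i \<notin> F\<close> the three-part formula holds trivially:
    \<open>F - {i} = F\<close>, and no deletion flat lies inside \<open>F\<close>.\<close>
  proof (cases "i \<in> F")
    case False
    then have "?c F = 0" by (intro sum.neutral) (auto simp: deletion_flats_def)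
    with False show ?thesis by (simp add: R_def)
  qed (simp add: R_def deletion_rhs_restriction[OF F])
  have w_E: "w ?E = 1" by (simp add: w_def moebius_refl)
  have E: "?E \<in> ?L" by (rule ground_in_flats)
  have "inv_Z_poly M - inv_KL_poly M + deletion_rhs M i =
      (\<Sum>F\<in>?L - {?E}. w F * inv_KL_poly (restriction M F)) + deletion_rhs M i"
    unfolding inv_Z_poly_eq sum.remove[OF finite_flats E] by (simp add: w_E restriction_ground)
  also have "(\<Sum>F\<in>?L - {?E}. w F * inv_KL_poly (restriction M F)) = (\<Sum>F\<in>?L - {?E}. w F * R F)"
    using IH by (intro sum.cong) (auto simp: R_def)
  also have "(\<Sum>F\<in>?L - {?E}. w F * R F) + deletion_rhs M i = (\<Sum>F\<in>?L. w F * R F)"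
    unfolding sum.remove[OF finite_flats E] using i(1) by (simp add: w_E R_def restriction_ground)
  also have "\<dots> = (\<Sum>F\<in>?L. w F * ?a F + w F * ?b F - w F * ?c F)"
    by (rule sum.cong[OF refl]) (simp only: R distrib_left right_diff_distrib)
  also have "\<dots> = (\<Sum>F\<in>?L. w F * ?a F) + (\<Sum>F\<in>?L. w F * ?b F) - (\<Sum>F\<in>?L. w F * ?c F)"
    by (simp only: sum.distrib sum_subtractf)
  also have "(\<Sum>F\<in>?L. w F * ?b F) = [:1, 1:] * inv_Z_poly (contraction M {i})"
    unfolding inv_Z_poly_contraction[OF i(2)] sum_distrib_left
    by (rule sum.mono_neutral_cong_right) (auto simp: finite_flats simp del: mult_pCons_left)
  also have "(\<Sum>F\<in>?L. w F * ?c F) = (\<Sum>F\<in>?L. \<Sum>G | G \<in> ?T \<and> G \<subseteq> F. w F * (?t G * inv_KL_poly (minor M G F)))"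
    by (simp only: sum_distrib_left)
  \<comment> \<open>With the deletion flat \<open>G\<close> outermost, the inner sum runs over all
    flats above \<open>G\<close> and is the inverse Z-polynomial of
    \<open>contraction M G\<close>.\<close>
  also have "\<dots> = (\<Sum>G\<in>?T. \<Sum>F | F \<in> ?L \<and> G \<subseteq> F. w F * (?t G * inv_KL_poly (minor M G F)))"
    by (rule sum.swap_restrict[OF finite_flats finite_deletion_flats])
  also have "\<dots> = (\<Sum>G\<in>?T. ?t G * inv_Z_poly (contraction M G))"
  proof (rule sum.cong[OF refl])
    fix G assume "G \<in> ?T"
    then have "G \<in> ?L" by (simp add: deletion_flats_def)
    then show "(\<Sum>F | F \<in> ?L \<and> G \<subseteq> F. w F * (?t G * inv_KL_poly (minor M G F))) =
        ?t G * inv_Z_poly (contraction M G)"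
      by (simp add: inv_Z_poly_contraction sum_distrib_left mult.left_commute)
  qed
  finally show ?thesis unfolding sum_deletion_part .
qed

section \<open>Palindromicity of the right-hand side\<close>

private lemma even_rk_deletion_flat:
  assumes "F \<in> deletion_flats M i" "tau (minor M {i} F) \<noteq> 0"
  shows "even (rk M F)" "0 < rk M F"
proof -
  have F: "F \<in> flats M" "i \<in> F" using assms(1) by (auto simp: deletion_flats_def)
  show "0 < rk M F" using rk_mono[of "{i}" F] F(2) rk_i by simp
  moreover have "odd (rank (minor M {i} F))" using assms(2) unfolding tau_def by presburger
  ultimately show "even (rk M F)" unfolding rank_minor_i[OF F] by auto
qed

private lemma palindromic_inv_Z_poly: "N \<in> loopless_matroids \<Longrightarrow> palindromic (rank N) (inv_Z_poly N)"
  using palindromic_inv_Z_sum[of N] inv_Z_poly_loopless[of N] by simp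

text \<open>Degrees match term by term: deleting a non-coloop keeps the rank, \<open>1 + x\<close>
  restores the degree lost by contracting \<open>i\<close>, and where \<open>tau\<close> is nonzero
  \<open>rk M F\<close> is even, so the monomial is palindromic of degree exactly
  \<open>rk M F\<close>.\<close>

private lemma palindromic_rhs:
  "palindromic (rank M)
    ((if coloop M i then 0 else inv_Z_poly (deletion M {i})) + [:1, 1:] * inv_Z_poly (contraction M {i})
    - (\<Sum>F\<in>deletion_flats M i.
         monom (tau (minor M {i} F)) (rk M F div 2) * inv_Z_poly (contraction M F)))"
proof (intro palindromic_diff palindromic_add palindromic_sum)
  show "palindromic (rank M) (if coloop M i then 0 else inv_Z_poly (deletion M {i}))"
  proof (cases "coloop M i")
    case False
    then have "rk M (ground M - {i}) = rank M"
      using i(1) rk_mono[of "ground M - {i}" "ground M"] by (auto simp: coloop_iff_rk)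
    then have "rank (deletion M {i}) = rank M" by (simp add: deletion_def rk_restriction)
    with palindromic_inv_Z_poly[OF deletion_in] False show ?thesis by (simp only: if_False)
  qed (simp add: palindromic_0)
  have "rank (contraction M {i}) = rank M - 1" using rank_contraction[OF i(2)] rk_i by (simp only:)
  then show "palindromic (rank M) ([:1, 1:] * inv_Z_poly (contraction M {i}))"
    using palindromic_mult[OF palindromic_1_plus_X palindromic_inv_Z_poly[OF contraction_in_loopless_matroids[OF M i(2)]]]
      rank_pos by (simp only: plus_1_eq_Suc Suc_diff_1 add_Suc add_0)
  fix F assume F: "F \<in> deletion_flats M i"
  then have flat: "F \<in> flats M" by (simp add: deletion_flats_def)
  show "palindromic (rank M) (monom (tau (minor M {i} F)) (rk M F div 2) * inv_Z_poly (contraction M F))"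
  proof (cases "tau (minor M {i} F) = 0")
    case False
    have "rk M F \<le> rank M" using flats_subset_ground[OF flat] by (rule rk_mono)
    then have "2 * (rk M F div 2) + rank (contraction M F) = rank M"
      using even_rk_deletion_flat(1)[OF F False] unfolding rank_contraction[OF flat] by auto
    then show ?thesis
      using palindromic_mult[OF palindromic_monom palindromic_inv_Z_poly[OF contraction_in_loopless_matroids[OF M flat]]]
      by metis
  qed (simp add: palindromic_0)
qed

section \<open>The degree bound for the right-hand side\<close>

private lemma coloop_deletion_eq_contraction:
  assumes "coloop M i"
  shows "deletion M {i} = contraction M {i}"
proof (rule matroid_eqI)
  show "finite_matroid (deletion M {i})" using loopless_matroidsD(1)[OF deletion_in] .
  show "finite_matroid (contraction M {i})" using i(1) by (intro finite_matroid_contraction) simp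
  fix X assume "X \<subseteq> ground (deletion M {i})"
  then have X: "X \<subseteq> ground M - {i}" by simp
  have "rk M (insert i X) \<noteq> rk M X"
  proof
    assume "rk M (insert i X) = rk M X"
    then have "rk M (insert i (ground M - {i})) = rk M (ground M - {i})" using X by (rule rk_insert_eq_mono)
    then show False using assms i(1) by (simp add: coloop_iff_rk insert_absorb)
  qed
  then have "rk M (insert i X) = Suc (rk M X)" using rk_insert_le[of i X] rk_le_insert[of X i] by simp
  then show "rk (deletion M {i}) X = rk (contraction M {i}) X"
    using X i(1) by (simp add: deletion_def rk_restriction inf.absorb1 rk_contraction rk_i)
qed simp

text \<open>For a coloop the two factors add up to \<open>-x + (1 + x) = 1\<close> and only the
  polynomial of the contraction, of smaller rank, remains. Otherwise only \<open>(1 + x)\<close>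
  times that polynomial and the summand at the ground set can reach half the rank, and there they
  cancel.\<close>

private lemma degree_deletion_rhs: "2 * degree (deletion_rhs M i) < rank M"
proof (cases "coloop M i")
  case True
  have "deletion_flats M i = {}" using coloop_remove_flat[OF True] by (auto simp: deletion_flats_def)
  then have "deletion_rhs M i = (monom (-1) 1 + [:1, 1:]) * inv_KL_poly (contraction M {i})"
    unfolding deletion_rhs_def coloop_deletion_eq_contraction[OF True] distrib_right using True by simp
  also have "monom (-1) 1 + [:1, 1:] = (1 :: int poly)" by (simp add: monom_altdef one_pCons)
  finally have rhs: "deletion_rhs M i = inv_KL_poly (contraction M {i})" by simp
  have "rank (contraction M {i}) = rank M - 1" using rank_contraction[OF i(2)] rk_i by (simp only:)
  then show ?thesis
    unfolding rhs using double_degree_inv_KL_poly_le[OF contraction_in_loopless_matroids[OF M i(2)]] rank_pos by linarith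
next
  case False
  let ?E = "ground M" and ?T = "deletion_flats M i" and ?Q = "inv_KL_poly (contraction M {i})"
  let ?t = "\<lambda>F. monom (tau (minor M {i} F)) (rk M F div 2) * inv_KL_poly (contraction M F)"
  have E: "?E \<in> ?T"
    using False i(1) coloop_iff_flat[OF i(1)] ground_in_flats[of M] by (simp add: deletion_flats_def)
  \<comment> \<open>Rank above 1 makes the contraction of positive rank, so that the strict degree
    bound applies to \<open>?Q\<close>.\<close>
  have "{i} \<noteq> ?E" using False coloop_iff_flat[OF i(1)] empty_flat by auto
  then have rank_gt: "rank M > 1" using rk_flats_strict_mono[OF i(2), of ?E] i(1) rk_i by auto
  have Q_in: "contraction M {i} \<in> loopless_matroids" by (rule contraction_in_loopless_matroids[OF M i(2)])
  have rank_Q: "rank (contraction M {i}) = rank M - 1" using rank_contraction[OF i(2)] rk_i by (simp only:)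
  then have deg_Q: "2 * degree ?Q < rank M - 1" using degree_inv_KL_poly[OF Q_in] rank_gt by simp
  have t_E: "?t ?E = monom (tau (contraction M {i})) (rank M div 2)"
    using inv_KL_poly_rank_0[OF contraction_in_loopless_matroids[OF M ground_in_flats]]
      rank_contraction[OF ground_in_flats] by (simp add: minor_ground)
  have coeff_0: "coeff (deletion_rhs M i) k = 0" if k: "rank M \<le> 2 * k" for k
  proof -
    have "rk M (?E - {i}) = rank M"
      using False i(1) rk_mono[of "?E - {i}" ?E] by (auto simp: coloop_iff_rk)
    then have "rank (deletion M {i}) = rank M" by (simp add: deletion_def rk_restriction)
    then have "coeff (inv_KL_poly (deletion M {i})) k = 0"
      using degree_inv_KL_poly[OF deletion_in] rank_pos k by (intro coeff_eq_0) linarith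
    moreover have "coeff (?t F) k = 0" if F: "F \<in> ?T - {?E}" for F
    proof (cases "tau (minor M {i} F) = 0")
      case tau: False
      have flat: "F \<in> flats M" using F by (simp add: deletion_flats_def)
      then have "rk M F < rank M" using F flats_subset_ground[OF flat] by (intro rk_flats_strict_mono) auto
      then have "2 * degree (inv_KL_poly (contraction M F)) < rank M - rk M F"
        using degree_inv_KL_poly[OF contraction_in_loopless_matroids[OF M flat]]
        unfolding rank_contraction[OF flat] by simp
      moreover have "even (rk M F)" using even_rk_deletion_flat F tau by blast
      ultimately have "degree (?t F) < k"
        using degree_mult_le[of "monom (tau (minor M {i} F)) (rk M F div 2)" "inv_KL_poly (contraction M F)"]
          degree_monom_le[of "tau (minor M {i} F)" "rk M F div 2"] k by (auto elim!: evenE)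
      then show ?thesis by (rule coeff_eq_0)
    qed simp
    then have "(\<Sum>F\<in>?T - {?E}. coeff (?t F) k) = 0" by (intro sum.neutral ballI)
    then have "coeff (\<Sum>F\<in>?T. ?t F) k = coeff (?t ?E) k"
      unfolding coeff_sum sum.remove[OF finite_deletion_flats E]
      by (simp only: coeff_add coeff_sum add_0_right)
    moreover have "coeff ([:1, 1:] * ?Q) k = coeff (?t ?E) k"
    proof -
      have "coeff ?Q k = 0" using deg_Q k by (intro coeff_eq_0) linarith
      \<comment> \<open>In these degrees only the \<open>x\<close> of \<open>1 + x\<close>
        contributes.\<close>
      then have "coeff ([:1, 1:] * ?Q) k = coeff ?Q (k - 1)"
        using k rank_pos by (cases k) auto
      also have "\<dots> = coeff (monom (tau (contraction M {i})) (rank M div 2)) k"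
      proof (cases "k = rank M div 2 \<and> even (rank M)")
        case True
        then have "odd (rank (contraction M {i}))" "k - 1 = (rank (contraction M {i}) - 1) div 2"
          unfolding rank_Q using rank_pos by auto
        then show ?thesis using coeff_inv_KL_poly_eq_tau[OF Q_in] True by simp
      next
        \<comment> \<open>Away from the critical degree both sides vanish: \<open>?Q\<close> has too
          small a degree, and the monomial sits at another exponent or has coefficient
          \<open>tau\<close> of a matroid of even rank.\<close>
        case False
        have "coeff ?Q (k - 1) = 0"
        proof (rule coeff_eq_0)
          show "degree ?Q < k - 1" using False deg_Q k by presburger
        qed
        moreover have "k \<noteq> rank M div 2 \<or> tau (contraction M {i}) = 0"
          using False rank_pos unfolding tau_def rank_Q by auto
        ultimately show ?thesis by auto
      qed
      finally show ?thesis unfolding t_E .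
    qed
    ultimately show ?thesis
      using False unfolding deletion_rhs_def by simp
  qed
  show ?thesis
  proof (rule ccontr)
    assume deg: "\<not> 2 * degree (deletion_rhs M i) < rank M"
    then have "deletion_rhs M i = 0" using coeff_0[of "degree (deletion_rhs M i)"] by simp
    then show False using deg rank_pos by simp
  qed
qed

section \<open>Induction and conclusion\<close>

text \<open>Both \<open>inv_Z_poly M\<close> and its modification by
  \<open>inv_Z_poly_replace\<close> are palindromic, so
  \<open>inv_KL_poly M - deletion_rhs M i\<close> is too; its degree is below half the rank, so it
  is 0. The second formula is then the replacement identity itself.\<close>

lemma inv_KL_poly_deletion_step:
  assumes IH: "\<And>F. F \<in> flats M \<Longrightarrow> i \<in> F \<Longrightarrow> F \<noteq> ground M \<Longrightarrow>
      inv_KL_poly (restriction M F) = deletion_rhs (restriction M F) i"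
  shows "inv_KL_poly M = deletion_rhs M i"
    and "inv_Z_poly M =
      (if coloop M i then 0 else inv_Z_poly (deletion M {i})) + [:1, 1:] * inv_Z_poly (contraction M {i})
      - (\<Sum>F\<in>deletion_flats M i.
           monom (tau (minor M {i} F)) (rk M F div 2) * inv_Z_poly (contraction M F))"
proof -
  have replace: "inv_Z_poly M - inv_KL_poly M + deletion_rhs M i =
      (if coloop M i then 0 else inv_Z_poly (deletion M {i})) + [:1, 1:] * inv_Z_poly (contraction M {i})
      - (\<Sum>F\<in>deletion_flats M i.
           monom (tau (minor M {i} F)) (rk M F div 2) * inv_Z_poly (contraction M F))"
    by (rule inv_Z_poly_replace) (rule IH)
  have "palindromic (rank M) (inv_Z_poly M - inv_KL_poly M + deletion_rhs M i)"
    unfolding replace by (rule palindromic_rhs)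
  then have "palindromic (rank M) (inv_Z_poly M - (inv_Z_poly M - inv_KL_poly M + deletion_rhs M i))"
    by (rule palindromic_diff[OF palindromic_inv_Z_poly[OF M]])
  then have "palindromic (rank M) (inv_KL_poly M - deletion_rhs M i)"
    by (simp add: algebra_simps)
  moreover have "2 * degree (inv_KL_poly M - deletion_rhs M i) < rank M"
    using degree_inv_KL_poly[OF M rank_pos] degree_deletion_rhs
      degree_diff_le_max[of "inv_KL_poly M" "deletion_rhs M i"] by linarith
  ultimately have "inv_KL_poly M - deletion_rhs M i = 0"
    by (rule palindromic_low_degree_eq_0)
  then show eq: "inv_KL_poly M = deletion_rhs M i" by simp
  show "inv_Z_poly M =
      (if coloop M i then 0 else inv_Z_poly (deletion M {i})) + [:1, 1:] * inv_Z_poly (contraction M {i})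
      - (\<Sum>F\<in>deletion_flats M i.
           monom (tau (minor M {i} F)) (rk M F div 2) * inv_Z_poly (contraction M F))"
    unfolding replace[symmetric] eq by (simp only: diff_add_cancel)
qed

end

text \<open>Restricting to a proper flat through \<open>i\<close> shrinks the ground set and keeps
  \<open>{i}\<close> a flat. Coloops are allowed since \<open>i\<close> may become one on the way
  down.\<close>

lemma inv_KL_poly_eq_deletion_rhs:
  assumes "M \<in> loopless_matroids" "i \<in> ground M" "{i} \<in> flats M"
  shows "inv_KL_poly M = deletion_rhs M i"
  using assms
proof (induction "card (ground M)" arbitrary: M rule: less_induct)
  case (less M)
  interpret finite_matroid M using loopless_matroidsD(1)[OF less.prems(1)] .
  show ?case
  proof (rule inv_KL_poly_deletion_step(1)[OF less.prems])
    fix F assume F: "F \<in> flats M" "i \<in> F" "F \<noteq> ground M"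
    then have sub: "F \<subset> ground M" using flats_subset_ground by blast
    show "inv_KL_poly (restriction M F) = deletion_rhs (restriction M F) i"
    proof (rule less.hyps)
      show "card (ground (restriction M F)) < card (ground M)"
        using sub finite_ground by (simp add: psubset_card_mono)
      show "restriction M F \<in> loopless_matroids"
        using sub by (intro restriction_in_loopless_matroids[OF less.prems(1)]) blast
      show "{i} \<in> flats (restriction M F)" using F less.prems(3) by (simp add: flats_restriction)
    qed (use F in simp)
  qed
qed

theorem theorem1p4:
  fixes M :: "'a matroid" and i :: 'a
  assumes "finite_matroid M"
    and "loopless M"
    and "i \<in> ground M"
    and "\<not> coloop M i"
    and "{i} \<in> flats M"
  shows
    "inv_KL_poly M =
       inv_KL_poly (deletion M {i}) + [:1, 1:] * inv_KL_poly (contraction M {i})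
       - (\<Sum>F\<in>deletion_flats M i.
            monom (tau (contraction (restriction M F) {i})) (rk M F div 2) * inv_KL_poly (contraction M F))
     \<and>
     inv_Z_poly M =
       inv_Z_poly (deletion M {i}) + [:1, 1:] * inv_Z_poly (contraction M {i})
       - (\<Sum>F\<in>deletion_flats M i.
            monom (tau (contraction (restriction M F) {i})) (rk M F div 2) * inv_Z_poly (contraction M F))"
proof -
  interpret finite_matroid M by fact
  have M: "M \<in> loopless_matroids" using assms(1,2) by (simp add: loopless_matroids_def)
  \<comment> \<open>With the formula known for every restriction, the hypothesis of the induction
    step holds outright and its second conclusion gives the formula for the inverse
    Z-polynomial.\<close>
  have "inv_KL_poly (restriction M F) = deletion_rhs (restriction M F) i"
    if F: "F \<in> flats M" "i \<in> F" for F
    using restriction_in_loopless_matroids[OF M flats_subset_ground[OF F(1)]] F assms(5)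
    by (intro inv_KL_poly_eq_deletion_rhs) (simp_all add: flats_restriction)
  then have "inv_Z_poly M =
      (if coloop M i then 0 else inv_Z_poly (deletion M {i})) + [:1, 1:] * inv_Z_poly (contraction M {i})
      - (\<Sum>F\<in>deletion_flats M i.
           monom (tau (minor M {i} F)) (rk M F div 2) * inv_Z_poly (contraction M F))"
    by (rule inv_KL_poly_deletion_step(2)[OF M assms(3,5)])
  with inv_KL_poly_eq_deletion_rhs[OF M assms(3,5)] assms(4) show ?thesis
    unfolding deletion_rhs_def[of M i] by (simp only: minor_def if_False mult_1)
qed

end
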